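(* Suppose that there exists a nonempty open subset $\Delta_0\subseteq\Delta=[-1,1]^d$ such that $h\Delta_0\subseteq\mathcal{V}(h)$ for all $h\in(0,\rho]$. Let $(s,L)\in(0,\infty)^2$ be given. Let $\gamma=(m,h)\in\Gamma$ be such that $$m=\lceil s\rceil-1\quad\text{and}\quad h=\left[\frac{1}{2s\,\mathfrak{L}_{m,s,L}^2}\times\frac{d\,\mathfrak{F}_{s,L}}{2^d\,n}\right]^{1/(2s+d)}.$$ Set $N_n(s,L)=n^{-s/(2s+d)}$. Then the following assertions hold: 1. $\{N_n(s,L):n\in\mathbb{N}\}$ is the minimax rate of convergence over $\Sigma(s,L)$. 2. The estimator $\hat f_\gamma(t)$ attains this rate of convergence. More precisely, for $n$ large enough, $$N_n^{-1}(s,L)\sup_{f\in\Sigma(s,L)}R_n(\hat f_\gamma,f)\le C(s,L),$$ where $$C(s,L)=\frac{2^d\sqrt{D_m}}{\lambda_\star(m)}\sqrt{\left(\frac{d}{2s}+1\right)\left(\frac{2s}{4^sd}\right)^{d/(2s+d)}}\ \mathfrak{F}_{s,L}^{\,s/(2s+d)}\,(\mathfrak{L}_{m,s,L})^{d/(2s+d)}.$$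
   Context: Setting. Let $d\in\mathbb{N}=\{1,2,\dots\}$ and let $\mathcal{D}$ be the closure of a nonempty open subset of $\mathbb{R}^d$, where $\mathbb{R}^d$ carries the sup norm $\|\cdot\|_\infty$. Fix $t\in\mathcal{D}$, put $\Delta=[-1,1]^d$ and, for $h>0$, $\mathcal{V}(h)=\{u\in\mathbb{R}^d: t+u\in\mathcal{D},\ \|u\|_\infty\le h\}$. Fix $\rho\in(0,e^{-1}]$ such that $\mathcal{V}(\rho)$ is a neighborhood of the origin for the topology on the (translated) domain $\mathcal{D}-t$ inherited from $\mathbb{R}^d$. Let $X,X_1,\dots,X_n$ be i.i.d. random variables supported on $\mathcal{D}$ with density $f$ with respect to Lebesgue measure; $\mathsf{E}$ is the corresponding expectation. An estimator is a measurable function of $(X_1,\dots,X_n)$; its pointwise risk is $R_n(\tilde f,f)=(\mathsf{E}[\{\tilde f(t)-f(t)\}^2])^{1/2}$. Hölder class. For $\alpha\in\mathbb{N}_0^d$, $|\alpha|=\sum_j\alpha_j$, $\varphi_\alpha(u)=\prod_{j=1}^d u_j^{\alpha_j}$; $\mathcal{P}_m=\mathrm{Span}(\varphi_\alpha:|\alpha|\le m)$ has dimension $D_m=\binom{m+d}{d}$. For $s,L>0$, a density $f:\mathcal{D}\to\mathbb{R}$ belongs to $\Sigma(s,L)$ if there is $q\in\mathcal{P}_{\lceil s\rceil-1}$ with $|f(t+u)-q(u)|\le L\|u\|_\infty^s$ for all $u\in\mathcal{V}(\rho)$ ($\lceil s\rceil-1$ is the greatest integer strictly less than $s$). Minimax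 rate. For nonnegative sequences, $u_n\lesssim v_n$ means $\limsup_{n\to\infty}u_n/v_n<\infty$. A sequence $(N_n)$ is the minimax rate of convergence over $\Sigma(s,L)$ if it has the same asymptotic order as $\inf_{\tilde f_n}\sup_{f\in\Sigma(s,L)}R_n(\tilde f_n,f)$ (each $\lesssim$ the other), the infimum being over all estimators. Local polynomial estimators. $\Gamma=\mathbb{N}_0\times(0,\rho]$. For $\gamma=(m,h)\in\Gamma$: $K=\mathbf{1}_\Delta$, $w_h(u)=h^{-d}K(h^{-1}u)\mathbf{1}_{\mathcal{D}}(t+u)$, $W_h=\int_{\mathbb{R}^d}w_h(u)\,du$; $\Phi_\gamma(u)=(\varphi_\alpha(u/h))_{|\alpha|\le m}$ as a column vector of length $D_m$ (graded by $|\alpha|$, lexicographic order within each degree); $\mathcal{B}_\gamma=\int\Phi_\gamma(u)\Phi_\gamma^\top(u)w_h(u)\,du$ (symmetric positive definite), with smallest eigenvalue $\lambda_\gamma>0$; $\mathcal{B}_\gamma^{1/2}$ is the lower triangular Cholesky factor of $\mathcal{B}_\gamma$; $H_\gamma(u)=\mathcal{B}_\gamma^{-1/2}\Phi_\gamma(u)$; and $\hat f_\gamma(t)=\frac1n\sum_{i=1}^n H_\gamma^\top(0)H_\gamma(X_i-t)w_h(X_i-t)$. Constants. $\mathfrak{L}_{m,s,L}>0$ is a constant (not depending on $f,h,n$) such that $|\mathsf{E}\{\hat f_{(m,h)}(t)\}-f(t)|\le\frac{W_h\sqrt{D_m}}{\lambda_{(m,h)}}\mathfrak{L}_{m,s,L}h^{\min(m+1,s)}$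 for all $h\in(0,\rho]$, $f\in\Sigma(s,L)$; such a constant exists and equals $L$ when $m\ge\lceil s\rceil-1$. $\mathfrak{F}_{s,L}$ is any (finite, positive) upper bound on $\sup_{f\in\Sigma(s,L)}\sup_{u\in\mathcal{V}(\rho)}|f(t+u)|$; such a bound exists. $\lambda_\star(m)>0$ is a constant with $\inf_{h\in(0,\rho]}\lambda_{(m,h)}\ge\lambda_\star(m)$; such a constant exists under the stated hypothesis on $\mathcal{D}$. *)

theory Defs
  imports
    "HOL-Analysis.Analysis"
    "HOL-Library.Fun_Lexorder"
    "Jordan_Normal_Form.Matrix"
    "Jordan_Normal_Form.Gauss_Jordan_Elimination"
    "Jordan_Normal_Form.Char_Poly"
begin

text \<open>
  Points live in \<open>real ^ 'n\<close>, with \<open>d = CARD('n)\<close>; the linear order on \<open>'n\<close> is the order of the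
  coordinates. The library's \<open>infnorm\<close> is the sup norm. Two types are called \<open>vec\<close>:
  \<open>real ^ 'n\<close> is used for points, \<open>Matrix.vec\<close> and \<open>Matrix.mat\<close> for the column vectors and
  matrices whose size depends on the degree \<open>m\<close>.
  A function on \<open>D\<close> is represented by a total function of which only the values on \<open>D\<close> are used.
\<close>

section \<open>Monomials and polynomials\<close>

definition mi_deg :: "('n::finite \<Rightarrow> nat) \<Rightarrow> nat" where
  "mi_deg \<alpha> = (\<Sum>j\<in>UNIV. \<alpha> j)"

definition mi_pow :: "('n::finite \<Rightarrow> nat) \<Rightarrow> real ^ 'n \<Rightarrow> real" where
  "mi_pow \<alpha> u = (\<Prod>j\<in>UNIV. (u $ j) ^ \<alpha> j)"

definition poly_space :: "nat \<Rightarrow> (real ^ 'n::finite \<Rightarrow> real) set" where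
  "poly_space m = {\<lambda>u. \<Sum>\<alpha> | mi_deg \<alpha> \<le> m. c \<alpha> * mi_pow \<alpha> u | c. True}"

definition poly_dim :: "'n::finite itself \<Rightarrow> nat \<Rightarrow> nat" where
  "poly_dim _ m = (m + CARD('n)) choose CARD('n)"

text \<open>
  Within a degree, the multi-index with the smaller entry at the first differing coordinate comes first.
\<close>

definition grlex_less :: "('n::{finite,linorder} \<Rightarrow> nat) \<Rightarrow> ('n \<Rightarrow> nat) \<Rightarrow> bool" where
  "grlex_less \<alpha> \<beta> \<longleftrightarrow> mi_deg \<alpha> < mi_deg \<beta> \<or> (mi_deg \<alpha> = mi_deg \<beta> \<and> less_fun \<alpha> \<beta>)"

definition mi_list :: "nat \<Rightarrow> ('n::{finite,linorder} \<Rightarrow> nat) list" where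
  "mi_list m = (THE xs. sorted_wrt grlex_less xs \<and> set xs = {\<alpha>. mi_deg \<alpha> \<le> m})"

section \<open>Densities, samples and risk\<close>

definition nbhd :: "(real ^ 'n::finite) set \<Rightarrow> real ^ 'n \<Rightarrow> real \<Rightarrow> (real ^ 'n) set" where
  "nbhd D t h = {u. t + u \<in> D \<and> infnorm u \<le> h}"

definition is_density_on :: "(real ^ 'n::finite) set \<Rightarrow> (real ^ 'n \<Rightarrow> real) \<Rightarrow> bool" where
  "is_density_on D f \<longleftrightarrow>
     f \<in> borel_measurable (restrict_space borel D) \<and> (\<forall>x\<in>D. 0 \<le> f x) \<and>
     (\<integral>\<^sup>+x\<in>D. ennreal (f x) \<partial>lborel) = 1"

definition law :: "(real ^ 'n::finite) set \<Rightarrow> (real ^ 'n \<Rightarrow> real) \<Rightarrow> (real ^ 'n) measure" where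
  "law D f = density lborel (\<lambda>x. ennreal (f x) * indicator D x)"

text \<open>The joint law of an i.i.d. sample \<open>(X\<^sub>1, \<dots>, X\<^sub>n)\<close>; \<open>X\<^sub>i\<close> is the \<open>i\<close>-th coordinate map.\<close>

definition sample_law ::
  "(real ^ 'n::finite) set \<Rightarrow> nat \<Rightarrow> (real ^ 'n \<Rightarrow> real) \<Rightarrow> (nat \<Rightarrow> real ^ 'n) measure" where
  "sample_law D n f = (\<Pi>\<^sub>M i\<in>{1..n}. law D f)"

definition estimators :: "nat \<Rightarrow> ((nat \<Rightarrow> real ^ 'n::finite) \<Rightarrow> real) set" where
  "estimators n = borel_measurable (\<Pi>\<^sub>M i\<in>{1..n}. borel)"

definition ennreal_sqrt :: "ennreal \<Rightarrow> ennreal" where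
  "ennreal_sqrt x = (if x = \<infinity> then \<infinity> else ennreal (sqrt (enn2real x)))"

text \<open>The risk is extended-valued, as an arbitrary estimator need not be square integrable.\<close>

definition risk :: "(real ^ 'n::finite) set \<Rightarrow> real ^ 'n \<Rightarrow> nat \<Rightarrow>
    ((nat \<Rightarrow> real ^ 'n) \<Rightarrow> real) \<Rightarrow> (real ^ 'n \<Rightarrow> real) \<Rightarrow> ennreal" where
  "risk D t n g f = ennreal_sqrt (\<integral>\<^sup>+X. ennreal ((g X - f t)\<^sup>2) \<partial>sample_law D n f)"

definition holder_class :: "(real ^ 'n::finite) set \<Rightarrow> real ^ 'n \<Rightarrow> real \<Rightarrow> real \<Rightarrow> real \<Rightarrow>
    (real ^ 'n \<Rightarrow> real) set" where
  "holder_class D t \<rho> s L =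
     {f. is_density_on D f \<and>
         (\<exists>q\<in>poly_space (nat (\<lceil>s\<rceil> - 1)). \<forall>u\<in>nbhd D t \<rho>. \<bar>f (t + u) - q u\<bar> \<le> L * infnorm u powr s)}"

definition max_risk :: "(real ^ 'n::finite) set \<Rightarrow> real ^ 'n \<Rightarrow> real \<Rightarrow> real \<Rightarrow> real \<Rightarrow> nat \<Rightarrow>
    ((nat \<Rightarrow> real ^ 'n) \<Rightarrow> real) \<Rightarrow> ennreal" where
  "max_risk D t \<rho> s L n g = (SUP f\<in>holder_class D t \<rho> s L. risk D t n g f)"

definition minimax_risk :: "(real ^ 'n::finite) set \<Rightarrow> real ^ 'n \<Rightarrow> real \<Rightarrow> real \<Rightarrow> real \<Rightarrow> nat \<Rightarrow>
    ennreal" where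
  "minimax_risk D t \<rho> s L n = (INF g\<in>estimators n. max_risk D t \<rho> s L n g)"

definition lesssim :: "(nat \<Rightarrow> ennreal) \<Rightarrow> (nat \<Rightarrow> ennreal) \<Rightarrow> bool" (infix "\<lesssim>" 50) where
  "u \<lesssim> v \<longleftrightarrow> limsup (\<lambda>n. u n / v n) < \<infinity>"

definition is_minimax_rate :: "(real ^ 'n::finite) set \<Rightarrow> real ^ 'n \<Rightarrow> real \<Rightarrow> real \<Rightarrow> real \<Rightarrow>
    (nat \<Rightarrow> real) \<Rightarrow> bool" where
  "is_minimax_rate D t \<rho> s L N \<longleftrightarrow>
     (\<lambda>n. ennreal (N n)) \<lesssim> minimax_risk D t \<rho> s L \<and>
     minimax_risk D t \<rho> s L \<lesssim> (\<lambda>n. ennreal (N n))"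

section \<open>Local polynomial estimators\<close>

definition kernel_wt :: "(real ^ 'n::finite) set \<Rightarrow> real ^ 'n \<Rightarrow> real \<Rightarrow> real ^ 'n \<Rightarrow> real" where
  "kernel_wt D t h u = (1 / h ^ CARD('n)) * indicator (cbox (-1) 1) ((1 / h) *\<^sub>R u) * indicator D (t + u)"

definition kernel_mass :: "(real ^ 'n::finite) set \<Rightarrow> real ^ 'n \<Rightarrow> real \<Rightarrow> real" where
  "kernel_mass D t h = (LINT u|lborel. kernel_wt D t h u)"

definition Phi :: "nat \<Rightarrow> real \<Rightarrow> real ^ 'n::{finite,linorder} \<Rightarrow> real Matrix.vec" where
  "Phi m h u = vec_of_list (map (\<lambda>\<alpha>. mi_pow \<alpha> ((1 / h) *\<^sub>R u)) (mi_list m))"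

definition gram_mat :: "(real ^ 'n::{finite,linorder}) set \<Rightarrow>
    real ^ 'n::{finite,linorder} \<Rightarrow> nat \<Rightarrow> real \<Rightarrow> real Matrix.mat" where
  "gram_mat D t m h =
     (let k = length (mi_list m :: ('n \<Rightarrow> nat) list) in
      Matrix.mat k k (\<lambda>(i, j). LINT u|lborel.
        vec_index (Phi m h u) i * vec_index (Phi m h u) j * kernel_wt D t h u))"

definition min_eigenvalue :: "real Matrix.mat \<Rightarrow> real" where
  "min_eigenvalue A = Min {k. eigenvalue A k}"

text \<open>The Cholesky factor is normalized, as usual, by a positive diagonal.\<close>

definition cholesky :: "real Matrix.mat \<Rightarrow> real Matrix.mat" where
  "cholesky A = (THE C. C \<in> carrier_mat (dim_row A) (dim_row A) \<and>
     upper_triangular (transpose_mat C) \<and> (\<forall>i<dim_row A. 0 < C $$ (i, i)) \<and>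
     C * transpose_mat C = A)"

definition H_vec :: "(real ^ 'n::{finite,linorder}) set \<Rightarrow>
    real ^ 'n::{finite,linorder} \<Rightarrow> nat \<Rightarrow> real \<Rightarrow>
    real ^ 'n::{finite,linorder} \<Rightarrow> real Matrix.vec" where
  "H_vec D t m h u = the (mat_inverse (cholesky (gram_mat D t m h))) *\<^sub>v Phi m h u"

definition lp_estimator :: "(real ^ 'n::{finite,linorder}) set \<Rightarrow>
    real ^ 'n::{finite,linorder} \<Rightarrow> nat \<Rightarrow> real \<Rightarrow>
    nat \<Rightarrow> (nat \<Rightarrow> real ^ 'n::{finite,linorder}) \<Rightarrow> real" where
  "lp_estimator D t m h n X =
     (1 / real n) * (\<Sum>i=1..n. scalar_prod (H_vec D t m h 0) (H_vec D t m h (X i - t))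
                             * kernel_wt D t h (X i - t))"

section \<open>The constants\<close>

text \<open>
  These predicates characterize the admissible values of the constants in the bias bound, of the uniform
  bound on the densities near \<open>t\<close>, and of the lower bound on the smallest eigenvalues. For
  \<open>m \<ge> \<lceil>s\<rceil> - 1\<close>, the bias constant \<open>c = L\<close> is admissible; no particular admissible value is singled out.
\<close>

definition is_bias_const :: "(real ^ 'n::{finite,linorder}) set \<Rightarrow>
    real ^ 'n::{finite,linorder} \<Rightarrow> real \<Rightarrow> nat \<Rightarrow> real \<Rightarrow> real \<Rightarrow>
    real \<Rightarrow> bool" where
  "is_bias_const D t \<rho> m s L c \<longleftrightarrow> 0 < c \<and>
     (\<forall>n\<ge>1. \<forall>h. 0 < h \<and> h \<le> \<rho> \<longrightarrow> (\<forall>f\<in>holder_class D t \<rho> s L.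
        \<bar>(LINT X|sample_law D n f. lp_estimator D t m h n X) - f t\<bar>
          \<le> kernel_mass D t h * sqrt (real (poly_dim TYPE('n) m)) / min_eigenvalue (gram_mat D t m h)
             * c * h powr min (real m + 1) s))"

definition is_sup_bound :: "(real ^ 'n::finite) set \<Rightarrow> real ^ 'n \<Rightarrow> real \<Rightarrow> real \<Rightarrow> real \<Rightarrow>
    real \<Rightarrow> bool" where
  "is_sup_bound D t \<rho> s L c \<longleftrightarrow> 0 < c \<and>
     (\<forall>f\<in>holder_class D t \<rho> s L. \<forall>u\<in>nbhd D t \<rho>. \<bar>f (t + u)\<bar> \<le> c)"

definition is_eigenvalue_bound :: "(real ^ 'n::{finite,linorder}) set \<Rightarrow>
    real ^ 'n::{finite,linorder} \<Rightarrow> real \<Rightarrow> nat \<Rightarrow>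
    real \<Rightarrow> bool" where
  "is_eigenvalue_bound D t \<rho> m c \<longleftrightarrow> 0 < c \<and>
     (\<forall>h. 0 < h \<and> h \<le> \<rho> \<longrightarrow> c \<le> min_eigenvalue (gram_mat D t m h))"

end

theory Submission
  imports Defs "HOL-Probability.Infinite_Product_Measure"
begin

text \<open>
  Upper bound. Let \<open>B\<close> be the Gram matrix and let \<open>v\<close> solve \<open>Bv = \<Phi>(0)\<close>. Whatever square root of \<open>B\<close>
  is used, \<open>H(0)\<^sup>TH(u) = v\<^sup>T\<Phi>(u)\<close>, so the estimator is the empirical mean of
  \<open>v\<^sup>T\<Phi>(X - t) w\<^sub>h(X - t)\<close>. Its variance is at most
  \<open>F (nh\<^sup>d)\<^sup>-\<^sup>1 \<integral> (v\<^sup>T\<Phi>)\<^sup>2 w\<^sub>h = F (nh\<^sup>d)\<^sup>-\<^sup>1 v\<^sup>T\<Phi>(0)\<close>, where \<open>F\<close> bounds the densities near \<open>t\<close>, and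
  \<open>v\<^sup>T\<Phi>(0) \<le> 1 / lam\<close> for a lower bound \<open>lam\<close> on the smallest eigenvalue, by the variational characterization of
  that eigenvalue (\<open>lp_estimator_representation\<close>, \<open>lp_estimator_risk\<close>). The assumed bound on the bias
  completes the estimate of the risk; the bandwidth balances the two terms, and inserting it gives the
  stated constant (\<open>optimal_bandwidth\<close>, \<open>max_risk_lp_estimator_le\<close>).

  Lower bound. By Le Cam's method it suffices to exhibit two densities in the class whose values at \<open>t\<close>
  differ by at least a fixed multiple of \<open>b\<^sup>s\<close>, with \<open>b = n\<^sup>-\<^sup>1\<^sup>/\<^sup>(\<^sup>2\<^sup>s\<^sup>+\<^sup>d\<^sup>)\<close>, while the likelihood ratio of the two samples
  has a second moment bounded in \<open>n\<close> (\<open>two_point_risk_lower_bound\<close>, \<open>minimax_risk_lower_bound\<close>). The class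
  restricts a density only through its distance to a polynomial near \<open>t\<close>, so a uniform density and one with a
  cusp of depth \<open>L b\<^sup>s\<close> at \<open>t\<close> will do.
\<close>

section \<open>Symmetric positive definite matrices\<close>

text \<open>Matrices are first treated as functions of two indices below \<open>k\<close>. Existence of the factor
  follows by induction on \<open>k\<close>, passing to the Schur complement of the first diagonal entry.\<close>

lemma cholesky_fun_exists:
  fixes a :: "nat \<Rightarrow> nat \<Rightarrow> real"
  assumes "\<And>i j. i < k \<Longrightarrow> j < k \<Longrightarrow> a i j = a j i"
    and "\<And>x. \<exists>i<k. x i \<noteq> 0 \<Longrightarrow> 0 < (\<Sum>i<k. \<Sum>j<k. a i j * x i * x j)"
  shows "\<exists>c. (\<forall>i<k. 0 < c i i) \<and> (\<forall>i j. i < j \<longrightarrow> c i j = 0)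
    \<and> (\<forall>i<k. \<forall>j<k. (\<Sum>l<k. c i l * c j l) = a i j)"
  using assms
proof (induction k arbitrary: a)
  case 0
  show ?case by (rule exI[of _ "\<lambda>_ _. 0"]) simp
next
  case (Suc k)
  note sym = Suc.prems(1) and pos = Suc.prems(2)
  have a00: "0 < a 0 0"
  proof -
    have "(\<Sum>i<Suc k. \<Sum>j<Suc k. a i j * (if i = 0 then 1 else 0) * (if j = 0 then 1 else 0)) = a 0 0"
      by (subst sum.lessThan_Suc_shift, subst sum.lessThan_Suc_shift) simp
    then show ?thesis using pos[of "\<lambda>i. if i = 0 then 1 else 0"] by auto
  qed
  define b where "b i j = a (Suc i) (Suc j) - a (Suc i) 0 * a (Suc j) 0 / a 0 0" for i j
  have "\<exists>c. (\<forall>i<k. 0 < c i i) \<and> (\<forall>i j. i < j \<longrightarrow> c i j = 0)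
    \<and> (\<forall>i<k. \<forall>j<k. (\<Sum>l<k. c i l * c j l) = b i j)"
  proof (rule Suc.IH)
    show "b i j = b j i" if "i < k" "j < k" for i j
      using sym[of "Suc i" "Suc j"] that by (simp add: b_def mult.commute)
    show "0 < (\<Sum>i<k. \<Sum>j<k. b i j * x i * x j)" if nz: "\<exists>i<k. x i \<noteq> 0" for x
    proof -
      define S where "S = (\<Sum>i<k. a (Suc i) 0 * x i)"
      define T where "T = (\<Sum>i<k. \<Sum>j<k. a (Suc i) (Suc j) * x i * x j)"
      \<comment> \<open>Minimize the quadratic form over its first variable.\<close>
      define y where "y i = (case i of 0 \<Rightarrow> - S / a 0 0 | Suc i \<Rightarrow> x i)" for i
      have y: "y 0 = - S / a 0 0" "y (Suc i) = x i" for i by (simp_all add: y_def)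
      have "\<exists>i<Suc k. y i \<noteq> 0" using nz y(2) by (metis Suc_less_eq)
      then have "0 < (\<Sum>i<Suc k. \<Sum>j<Suc k. a i j * y i * y j)" by (rule pos)
      also have "\<dots> = a 0 0 * y 0 * y 0 + (\<Sum>j<k. a 0 (Suc j) * y 0 * x j)
           + ((\<Sum>i<k. a (Suc i) 0 * x i * y 0) + T)"
        by (simp add: sum.lessThan_Suc_shift y(2) sum.distrib T_def del: sum.lessThan_Suc)
      also have "(\<Sum>j<k. a 0 (Suc j) * y 0 * x j) = y 0 * S"
        unfolding S_def sum_distrib_left
        by (intro sum.cong refl) (use sym[of 0] in \<open>auto simp: mult_ac\<close>)
      also have "(\<Sum>i<k. a (Suc i) 0 * x i * y 0) = y 0 * S"
        unfolding S_def sum_distrib_left by (intro sum.cong refl) (auto simp: mult_ac)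
      also have "a 0 0 * y 0 * y 0 + y 0 * S + (y 0 * S + T) = T - S * S / a 0 0"
        using a00 by (simp add: y(1) field_simps)
      also have "\<dots> = (\<Sum>i<k. \<Sum>j<k. b i j * x i * x j)"
      proof -
        have "S * S / a 0 0 = (\<Sum>i<k. \<Sum>j<k. a (Suc i) 0 * a (Suc j) 0 / a 0 0 * x i * x j)"
          unfolding S_def sum_product sum_divide_distrib by (intro sum.cong refl) simp
        then show ?thesis
          by (simp add: T_def b_def sum_subtractf left_diff_distrib)
      qed
      finally show ?thesis .
    qed
  qed
  then obtain c where c: "\<forall>i<k. 0 < c i i" "\<forall>i j. i < j \<longrightarrow> c i j = 0"
    "\<And>i j. i < k \<Longrightarrow> j < k \<Longrightarrow> (\<Sum>l<k. c i l * c j l) = b i j" by blast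
  define e where "e i j = (case j of 0 \<Rightarrow> a i 0 / sqrt (a 0 0)
    | Suc j \<Rightarrow> (case i of 0 \<Rightarrow> 0 | Suc i \<Rightarrow> c i j))" for i j
  have e: "e i 0 = a i 0 / sqrt (a 0 0)" "e 0 (Suc j) = 0" "e (Suc i) (Suc j) = c i j" for i j
    by (simp_all add: e_def)
  show ?case
  proof (intro exI[of _ e] conjI allI impI)
    show "0 < e i i" if "i < Suc k" for i
      using that c(1) a00 by (cases i) (auto simp: e)
    show "e i j = 0" if "i < j" for i j
      using that c(2) by (cases i; cases j) (auto simp: e)
    show "(\<Sum>l<Suc k. e i l * e j l) = a i j" if "i < Suc k" "j < Suc k" for i j
    proof -
      have "(\<Sum>l<Suc k. e i l * e j l) = a i 0 * a j 0 / a 0 0 + (\<Sum>l<k. e i (Suc l) * e j (Suc l))"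
        using a00 by (simp add: sum.lessThan_Suc_shift e(1) del: sum.lessThan_Suc)
      also have "\<dots> = a i j"
        using that c(3) sym[of 0 j] a00 by (cases i; cases j) (auto simp: e b_def)
      finally show ?thesis .
    qed
  qed
qed

lemma cholesky_fun_unique:
  fixes c e :: "nat \<Rightarrow> nat \<Rightarrow> real"
  assumes c: "\<And>i. i < k \<Longrightarrow> 0 < c i i" "\<And>i j. i < j \<Longrightarrow> j < k \<Longrightarrow> c i j = 0"
    and e: "\<And>i. i < k \<Longrightarrow> 0 < e i i" "\<And>i j. i < j \<Longrightarrow> j < k \<Longrightarrow> e i j = 0"
    and eq: "\<And>i j. i < k \<Longrightarrow> j < k \<Longrightarrow> (\<Sum>l<k. c i l * c j l) = (\<Sum>l<k. e i l * e j l)"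
    and "i < k" "j < k"
  shows "c i j = e i j"
  using \<open>j < k\<close> \<open>i < k\<close>
proof (induction j arbitrary: i rule: less_induct)
  case (less j)
  have split: "(\<Sum>l<k. g i l * g j l) = (\<Sum>l<j. g i l * g j l) + g i j * g j j"
    if "\<And>l. j < l \<Longrightarrow> l < k \<Longrightarrow> g j l = 0" for g :: "nat \<Rightarrow> nat \<Rightarrow> real" and i
  proof -
    have "(\<Sum>l<k. g i l * g j l) = (\<Sum>l<Suc j. g i l * g j l)"
      by (rule sum.mono_neutral_right) (use less.prems that in auto)
    then show ?thesis by simp
  qed
  have *: "c i j * c j j = e i j * e j j" if "i < k" for i
  proof -
    have "(\<Sum>l<j. c i l * c j l) = (\<Sum>l<j. e i l * e j l)"
      using less that by (intro sum.cong refl) auto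
    then show ?thesis
      using eq[OF that less.prems(1)] split[of c i] split[of e i] c(2) e(2) by simp
  qed
  have "c j j = e j j"
    using *[OF less.prems(1)] c(1) e(1) less.prems(1)
    by (metis power2_eq_square power2_eq_iff_nonneg less_imp_le)
  then show ?case using *[OF less.prems(2)] e(1)[OF less.prems(1)] by simp
qed

text \<open>Rayleigh quotient: the minimum of a quadratic form on the unit sphere is attained, and the
  minimizer is an eigenvector. Vectors of length \<open>k\<close> are sequences vanishing from index \<open>k\<close> on, so that
  the sphere is a closed subset of a compact product.\<close>

lemma quadratic_form_min_eigenpair:
  fixes a :: "nat \<Rightarrow> nat \<Rightarrow> real"
  assumes "0 < k" and sym: "\<And>i j. i < k \<Longrightarrow> j < k \<Longrightarrow> a i j = a j i"
  shows "\<exists>\<mu> x. (\<exists>i<k. x i \<noteq> 0) \<and> (\<forall>i<k. (\<Sum>j<k. a i j * x j) = \<mu> * x i)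
    \<and> (\<forall>y. \<mu> * (\<Sum>i<k. (y i)\<^sup>2) \<le> (\<Sum>i<k. \<Sum>j<k. a i j * y i * y j))"
proof -
  define Q where "Q y = (\<Sum>i<k. \<Sum>j<k. a i j * y i * y j)" for y :: "nat \<Rightarrow> real"
  define P where "P y = (\<Sum>i<k. (y i)\<^sup>2)" for y :: "nat \<Rightarrow> real"
  define S where "S = (\<Pi>\<^sub>E i\<in>UNIV. if i < k then {-1..1::real} else {0}) \<inter> {x. P x = 1}"
  have contP: "continuous_on UNIV P"
    unfolding P_def by (intro continuous_intros continuous_on_product_coordinates)
  have contQ: "continuous_on UNIV Q"
    unfolding Q_def by (intro continuous_intros continuous_on_product_coordinates)
  have "compact (\<Pi>\<^sub>E i\<in>UNIV. if i < k then {-1..1::real} else {0})"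
  proof -
    have "compactin (product_topology (\<lambda>i. euclidean) UNIV) (\<Pi>\<^sub>E i\<in>UNIV. if i < k then {-1..1::real} else {0})"
      unfolding compactin_PiE by auto
    then show ?thesis by (simp add: euclidean_product_topology)
  qed
  moreover have "closed {x. P x = 1}"
    by (rule closed_Collect_eq) (auto intro: contP continuous_on_const)
  ultimately have "compact S" unfolding S_def by blast
  moreover have "S \<noteq> {}"
  proof -
    have "P (\<lambda>i. if i = 0 then 1 else 0) = 1"
      unfolding P_def using \<open>0 < k\<close> by (simp add: if_distrib[of "\<lambda>x. x^2"] cong: if_cong)
    then have "(\<lambda>i. if i = 0 then 1 else 0) \<in> S"
      using \<open>0 < k\<close> by (auto simp: S_def)
    then show ?thesis by auto
  qed
  ultimately obtain x where x: "x \<in> S" "\<And>y. y \<in> S \<Longrightarrow> Q x \<le> Q y"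
    using continuous_attains_inf[of S Q] continuous_on_subset[OF contQ] by blast
  have Px: "P x = 1" using x by (simp add: S_def)
  define \<mu> where "\<mu> = Q x"
  have scale: "Q (\<lambda>i. r * y i) = r\<^sup>2 * Q y" "P (\<lambda>i. r * y i) = r\<^sup>2 * P y" for r y
    by (simp_all add: Q_def P_def sum_distrib_left power2_eq_square mult_ac)
  have low: "\<mu> * P y \<le> Q y" for y
  proof (cases "P y = 0")
    case True
    then have "\<forall>i<k. y i = 0"
      unfolding P_def by (subst (asm) sum_nonneg_eq_0_iff) auto
    then have "Q y = 0" by (simp add: Q_def)
    then show ?thesis using True by simp
  next
    case False
    have "0 \<le> P y" by (simp add: P_def sum_nonneg)
    then have pos: "0 < P y" using False by simp
    define z where "z i = (if i < k then y i / sqrt (P y) else 0)" for i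
    have z1: "P z = 1 / P y * P y"
    proof -
      have "P z = P (\<lambda>i. 1 / sqrt (P y) * y i)" by (simp add: P_def z_def)
      then show ?thesis using pos scale(2)[of "1 / sqrt (P y)" y] by (simp add: power_divide)
    qed
    have z2: "Q z = 1 / P y * Q y"
    proof -
      have "Q z = Q (\<lambda>i. 1 / sqrt (P y) * y i)" by (simp add: Q_def z_def)
      then show ?thesis using pos scale(1)[of "1 / sqrt (P y)" y] by (simp add: power_divide)
    qed
    have "\<bar>z i\<bar> \<le> 1" if "i < k" for i
    proof -
      have "(z i)\<^sup>2 \<le> P z" unfolding P_def by (rule member_le_sum) (use that in auto)
      also have "\<dots> = 1" using z1 False by simp
      finally show ?thesis by (simp add: abs_square_le_1)
    qed
    moreover have "z i = 0" if "\<not> i < k" for i using that by (simp add: z_def)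
    ultimately have "z \<in> S" using z1 False by (auto simp: S_def abs_le_iff minus_le_iff)
    then have "\<mu> \<le> 1 / P y * Q y" using x(2) z2 \<mu>_def by fastforce
    then show ?thesis using pos by (simp add: field_simps)
  qed
  have eig: "(\<Sum>j<k. a i j * x j) = \<mu> * x i" if i: "i < k" for i
  proof -
    define g where "g = (\<Sum>j<k. a i j * x j) - \<mu> * x i"
    \<comment> \<open>First-order condition at the minimizer, in the direction of the i-th coordinate.\<close>
    define y where "y r l = x l + r * (if l = i then 1 else 0)" for r l
    have Py: "P (y r) = 1 + 2 * r * x i + r\<^sup>2" for r
    proof -
      have "P (y r) = (\<Sum>l<k. (x l)\<^sup>2 + (if l = i then 2 * r * x i + r\<^sup>2 else 0))"
        unfolding P_def y_def by (intro sum.cong refl) (simp add: power2_eq_square algebra_simps)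
      then show ?thesis using i Px by (simp add: sum.distrib P_def)
    qed
    have Qy: "Q (y r) = \<mu> + 2 * r * (\<Sum>j<k. a i j * x j) + r\<^sup>2 * a i i" for r
    proof -
      have "Q (y r) = (\<Sum>l<k. \<Sum>j<k. a l j * x l * x j
          + (if j = i then r * (a l i * x l) else 0) + (if l = i then r * (a i j * x j) else 0)
          + (if l = i then (if j = i then r\<^sup>2 * a i i else 0) else 0))"
        unfolding Q_def y_def by (intro sum.cong refl) (simp add: power2_eq_square algebra_simps)
      also have "\<dots> = \<mu> + (\<Sum>l<k. r * (a l i * x l)) + (\<Sum>j<k. r * (a i j * x j)) + r\<^sup>2 * a i i"
      proof -
        have "(\<Sum>l<k. \<Sum>j<k. if l = i then r * (a i j * x j) else 0) = (\<Sum>j<k. r * (a i j * x j))"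
          by (subst sum.swap) (use i in simp)
        moreover have "(\<Sum>l<k. \<Sum>j<k. if l = i then (if j = i then r\<^sup>2 * a i i else 0) else 0) = r\<^sup>2 * a i i"
          by (subst sum.swap) (use i in simp)
        ultimately show ?thesis using i by (simp add: sum.distrib \<mu>_def Q_def)
      qed
      also have "(\<Sum>l<k. r * (a l i * x l)) = (\<Sum>j<k. r * (a i j * x j))"
        by (intro sum.cong refl) (use i sym in auto)
      finally show ?thesis by (simp add: sum_distrib_left mult.assoc)
    qed
    have quad: "0 \<le> r * (2 * g + r * (a i i - \<mu>))" for r
      using low[of "y r"] unfolding Py Qy g_def by (simp add: algebra_simps power2_eq_square)
    define R where "R = 1 + \<bar>a i i - \<mu>\<bar>"
    have R: "0 < R" by (simp add: R_def)
    have "0 \<le> (- g / R) * (2 * g + (- g / R) * (a i i - \<mu>))" by (rule quad)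
    also have "\<dots> = - (g\<^sup>2 / R) * (2 - (a i i - \<mu>) / R)"
      using R by (simp add: field_simps power2_eq_square)
    finally have "g\<^sup>2 / R * (2 - (a i i - \<mu>) / R) \<le> 0" by simp
    moreover have "0 < 2 - (a i i - \<mu>) / R"
    proof -
      have "a i i - \<mu> \<le> R" by (simp add: R_def)
      then have "(a i i - \<mu>) / R \<le> 1" using R by simp
      then show ?thesis by simp
    qed
    ultimately have "g\<^sup>2 / R \<le> 0" by (smt (verit) mult_pos_pos)
    then have "g = 0" using R by (simp add: divide_le_0_iff)
    then show ?thesis by (simp add: g_def)
  qed
  have "\<exists>i<k. x i \<noteq> 0"
  proof (rule ccontr)
    assume "\<not> ?thesis"
    then have "P x = 0" by (simp add: P_def)
    then show False using Px by simp
  qed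
  then show ?thesis using eig low unfolding P_def Q_def by blast
qed

lemma finite_eigenvalues:
  fixes A :: "real mat"
  assumes "A \<in> carrier_mat k k"
  shows "finite {\<mu>. eigenvalue A \<mu>}"
proof -
  have "char_poly A \<noteq> 0" using degree_monic_char_poly[OF assms] by auto
  then show ?thesis
    using poly_roots_finite[of "char_poly A"] eigenvalue_root_char_poly[OF assms] by simp
qed

lemma min_eigenvalue_le_quadratic_form:
  fixes A :: "real mat"
  assumes A: "A \<in> carrier_mat k k" and sym: "\<And>i j. i < k \<Longrightarrow> j < k \<Longrightarrow> A $$ (i, j) = A $$ (j, i)"
    and "0 < k"
  shows "min_eigenvalue A * (\<Sum>i<k. (y i)\<^sup>2) \<le> (\<Sum>i<k. \<Sum>j<k. A $$ (i, j) * y i * y j)"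
proof -
  obtain \<mu> x where x: "\<exists>i<k. x i \<noteq> 0" "\<And>i. i < k \<Longrightarrow> (\<Sum>j<k. A $$ (i, j) * x j) = \<mu> * x i"
    and low: "\<And>y. \<mu> * (\<Sum>i<k. (y i)\<^sup>2) \<le> (\<Sum>i<k. \<Sum>j<k. A $$ (i, j) * y i * y j)"
    using quadratic_form_min_eigenpair[of k "\<lambda>i j. A $$ (i, j)", OF \<open>0 < k\<close> sym] by auto
  have "eigenvector A (Matrix.vec k x) \<mu>"
    unfolding eigenvector_def
  proof (intro conjI)
    show "Matrix.vec k x \<in> carrier_vec (dim_row A)" using A by auto
    show "Matrix.vec k x \<noteq> 0\<^sub>v (dim_row A)"
      using x(1) A by (metis carrier_matD(1) index_vec index_zero_vec(1))
    show "A *\<^sub>v Matrix.vec k x = \<mu> \<cdot>\<^sub>v Matrix.vec k x"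
      by (rule eq_vecI) (use A x(2) in \<open>auto simp: scalar_prod_def atLeast0LessThan\<close>)
  qed
  then have "eigenvalue A \<mu>" by (auto simp: eigenvalue_def)
  then have "min_eigenvalue A \<le> \<mu>"
    unfolding min_eigenvalue_def using finite_eigenvalues[OF A] by (intro Min_le) auto
  then have "min_eigenvalue A * (\<Sum>i<k. (y i)\<^sup>2) \<le> \<mu> * (\<Sum>i<k. (y i)\<^sup>2)"
    by (intro mult_right_mono sum_nonneg) auto
  then show ?thesis using low[of y] by linarith
qed

text \<open>The description that defines \<^const>\<open>cholesky\<close> is satisfied by exactly one matrix if the matrix is
  symmetric and positive definite.\<close>

lemma cholesky_spec:
  fixes A :: "real mat"
  assumes A: "A \<in> carrier_mat k k" and sym: "\<And>i j. i < k \<Longrightarrow> j < k \<Longrightarrow> A $$ (i, j) = A $$ (j, i)"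
    and pos: "\<And>x. \<exists>i<k. x i \<noteq> 0 \<Longrightarrow> 0 < (\<Sum>i<k. \<Sum>j<k. A $$ (i, j) * x i * x j)"
  shows "cholesky A \<in> carrier_mat k k" "upper_triangular (transpose_mat (cholesky A))"
    "\<And>i. i < k \<Longrightarrow> 0 < cholesky A $$ (i, i)" "cholesky A * transpose_mat (cholesky A) = A"
proof -
  let ?R = "\<lambda>C. C \<in> carrier_mat (dim_row A) (dim_row A) \<and>
     upper_triangular (transpose_mat C) \<and> (\<forall>i<dim_row A. 0 < C $$ (i, i)) \<and>
     C * transpose_mat C = A"
  have k: "dim_row A = k" using A by simp
  obtain c where c: "\<forall>i<k. 0 < c i i" "\<forall>i j. i < j \<longrightarrow> c i j = 0"
    "\<forall>i<k. \<forall>j<k. (\<Sum>l<k. c i l * c j l) = A $$ (i, j)"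
    using cholesky_fun_exists[of k "\<lambda>i j. A $$ (i, j)"] sym pos by blast
  have ex: "?R (Matrix.mat k k (\<lambda>(i, j). c i j))"
    unfolding k
  proof (intro conjI)
    show "Matrix.mat k k (\<lambda>(i, j). c i j) * transpose_mat (Matrix.mat k k (\<lambda>(i, j). c i j)) = A"
      by (rule eq_matI) (use A c(3) in \<open>auto simp: scalar_prod_def atLeast0LessThan\<close>)
  qed (use c in auto)
  have prod: "(\<Sum>l<k. C $$ (i, l) * C $$ (j, l)) = A $$ (i, j)" if "?R C" "i < k" "j < k" for C i j
  proof -
    have "A $$ (i, j) = (C * transpose_mat C) $$ (i, j)" using that by simp
    also have "\<dots> = (\<Sum>l<k. C $$ (i, l) * C $$ (j, l))"
      using that A by (auto simp: scalar_prod_def atLeast0LessThan simp del: upper_triangular_def)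
    finally show ?thesis by simp
  qed
  have lower: "C $$ (i, j) = 0" if "?R C" "i < j" "j < k" for C i j
  proof -
    have C: "C \<in> carrier_mat k k" "upper_triangular (transpose_mat C)" using that(1) k by metis+
    then have "transpose_mat C $$ (j, i) = 0"
      using that(2,3) by (intro upper_triangularD) auto
    then show ?thesis using C(1) that(2,3) by simp
  qed
  have unique: "C = E" if C: "?R C" and E: "?R E" for C E
  proof (rule eq_matI)
    have dims: "dim_row C = k" "dim_col C = k" "dim_row E = k" "dim_col E = k"
      using C E k by (metis carrier_matD)+
    then show "dim_row C = dim_row E" "dim_col C = dim_col E" by auto
    show "C $$ (i, j) = E $$ (i, j)" if "i < dim_row E" "j < dim_col E" for i j
    proof (rule cholesky_fun_unique[of k "\<lambda>i j. C $$ (i, j)" "\<lambda>i j. E $$ (i, j)"])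
      show "(\<Sum>l<k. C $$ (i, l) * C $$ (j, l)) = (\<Sum>l<k. E $$ (i, l) * E $$ (j, l))"
        if "i < k" "j < k" for i j using prod[OF C that] prod[OF E that] by simp
      show "C $$ (i, j) = 0" "E $$ (i, j) = 0" if "i < j" "j < k" for i j
        using lower[OF C that] lower[OF E that] by auto
      show "0 < C $$ (i, i)" "0 < E $$ (i, i)" if "i < k" for i using C E that k by blast+
      show "i < k" "j < k" using that dims by auto
    qed
  qed
  have "?R (cholesky A)"
    unfolding cholesky_def by (rule theI[of ?R, OF ex unique]) (assumption, rule ex)
  then show "cholesky A \<in> carrier_mat k k" "upper_triangular (transpose_mat (cholesky A))"
    "\<And>i. i < k \<Longrightarrow> 0 < cholesky A $$ (i, i)" "cholesky A * transpose_mat (cholesky A) = A"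
    unfolding k by auto
qed

text \<open>With \<open>C\<close> the Cholesky factor of \<open>A\<close>, the bilinear form \<open>(C\<inverse>x)\<^sup>T(C\<inverse>y)\<close> is \<open>v\<^sup>Ty\<close> where \<open>Av = x\<close>;
  so the choice of the square root of \<open>A\<close> plays no role in the estimator.\<close>

lemma cholesky_inverse_scalar_prod:
  fixes A :: "real mat"
  assumes A: "A \<in> carrier_mat k k" and sym: "\<And>i j. i < k \<Longrightarrow> j < k \<Longrightarrow> A $$ (i, j) = A $$ (j, i)"
    and pos: "\<And>x. \<exists>i<k. x i \<noteq> 0 \<Longrightarrow> 0 < (\<Sum>i<k. \<Sum>j<k. A $$ (i, j) * x i * x j)"
    and x: "x \<in> carrier_vec k"
  shows "\<exists>v\<in>carrier_vec k. A *\<^sub>v v = x \<and> (\<forall>y\<in>carrier_vec k.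
      scalar_prod (the (mat_inverse (cholesky A)) *\<^sub>v x) (the (mat_inverse (cholesky A)) *\<^sub>v y)
      = scalar_prod v y)"
proof -
  define C where "C = cholesky A"
  have C: "C \<in> carrier_mat k k" "upper_triangular (transpose_mat C)" "\<And>i. i < k \<Longrightarrow> 0 < C $$ (i, i)"
    "C * transpose_mat C = A"
    using cholesky_spec[OF A sym pos] by (simp_all add: C_def)
  have "det C = det (transpose_mat C)" using C(1) by (simp add: det_transpose)
  also have "\<dots> = prod_list (diag_mat (transpose_mat C))"
    by (rule det_upper_triangular[OF C(2)]) (use C in auto)
  also have "\<dots> \<noteq> 0"
    using C(1,3) by (fastforce simp: prod_list_zero_iff diag_mat_def)
  finally have "C \<in> Units (ring_mat TYPE(real) k ())" by (rule det_non_zero_imp_unit[OF C(1)])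
  then obtain B where "mat_inverse C = Some B"
    using mat_inverse(1)[OF C(1), of "()"] by (cases "mat_inverse C") auto
  note B = mat_inverse(2)[OF C(1) this] \<open>mat_inverse C = Some B\<close>
  define v where "v = transpose_mat B *\<^sub>v (B *\<^sub>v x)"
  have v: "v \<in> carrier_vec k" using B x by (auto simp: v_def)
  have Bx: "B *\<^sub>v x \<in> carrier_vec k" using B x by auto
  have "A *\<^sub>v v = C *\<^sub>v (transpose_mat C *\<^sub>v v)"
    using assoc_mult_mat_vec[of C k k "transpose_mat C" k v] C(1,4) v by simp
  also have "transpose_mat C *\<^sub>v v = (transpose_mat C * transpose_mat B) *\<^sub>v (B *\<^sub>v x)"
    unfolding v_def using assoc_mult_mat_vec[of "transpose_mat C" k k "transpose_mat B" k "B *\<^sub>v x"] C(1) B(1) Bx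
    by simp
  also have "transpose_mat C * transpose_mat B = transpose_mat (B * C)"
    by (rule transpose_mult[symmetric]) (use C(1) B(1) in auto)
  also have "\<dots> = 1\<^sub>m k" using B(1) by (metis transpose_one)
  also have "C *\<^sub>v (1\<^sub>m k *\<^sub>v (B *\<^sub>v x)) = (C * B) *\<^sub>v x"
    using assoc_mult_mat_vec[of C k k B k x] C(1) B(1) Bx x by simp
  also have "\<dots> = x" using B x by simp
  finally have "A *\<^sub>v v = x" .
  moreover have "scalar_prod (B *\<^sub>v x) (B *\<^sub>v y) = scalar_prod v y" if "y \<in> carrier_vec k" for y
    unfolding v_def using transpose_vec_mult_scalar[of B k k y "B *\<^sub>v x"] B Bx that by simp
  ultimately show ?thesis using v B(2) by (auto simp: C_def)
qed

section \<open>Multi-indices, monomials and the sup norm\<close>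

lemma finite_mi_deg: "finite {\<alpha> :: 'n::finite \<Rightarrow> nat. mi_deg \<alpha> \<le> m}"
proof (rule finite_subset)
  have "\<alpha> j \<le> m" if "mi_deg \<alpha> \<le> m" for \<alpha> :: "'n \<Rightarrow> nat" and j
    using member_le_sum[of j UNIV \<alpha>] that by (simp add: mi_deg_def)
  then show "{\<alpha> :: 'n \<Rightarrow> nat. mi_deg \<alpha> \<le> m} \<subseteq> PiE UNIV (\<lambda>_. {..m})" by auto
qed (intro finite_PiE; simp)

lemma grlex_less_asym: "grlex_less \<alpha> \<beta> \<Longrightarrow> \<not> grlex_less \<beta> \<alpha>"
  unfolding grlex_less_def using less_fun_asym by (metis order_less_asym order_less_irrefl)

lemma grlex_less_trans: "grlex_less \<alpha> \<beta> \<Longrightarrow> grlex_less \<beta> \<gamma> \<Longrightarrow> grlex_less \<alpha> \<gamma>"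
  unfolding grlex_less_def using less_fun_trans by (metis order_less_trans)

lemma grlex_less_total: "grlex_less \<alpha> \<beta> \<or> \<alpha> = \<beta> \<or> grlex_less \<beta> \<alpha>"
  unfolding grlex_less_def using less_fun_trichotomy[of \<alpha> \<beta>] by (metis finite linorder_less_linear)

lemma sorted_wrt_grlex_exists:
  assumes "finite A"
  shows "\<exists>xs. sorted_wrt grlex_less xs \<and> set xs = A"
  using assms
proof (induction A)
  case (insert x A)
  then obtain xs where xs: "sorted_wrt grlex_less xs" "set xs = A" by blast
  let ?ys = "filter (\<lambda>y. grlex_less y x) xs @ x # filter (\<lambda>y. grlex_less x y) xs"
  have "sorted_wrt grlex_less ?ys"
    using xs(1) by (auto simp: sorted_wrt_append sorted_wrt_filter intro: grlex_less_trans)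
  moreover have "set ?ys = insert x A"
    using xs(2) grlex_less_total[of _ x] by (auto simp: grlex_less_asym)
  ultimately show ?case by blast
qed simp

lemma sorted_wrt_grlex_unique:
  assumes "sorted_wrt grlex_less xs" "sorted_wrt grlex_less ys" "set xs = set ys"
  shows "xs = ys"
  using assms
proof (induction xs arbitrary: ys)
  case (Cons x xs)
  then obtain y ys' where ys: "ys = y # ys'" by (cases ys) auto
  have "x = y"
  proof (rule ccontr)
    assume "x \<noteq> y"
    then have "x \<in> set ys'" "y \<in> set xs" using Cons.prems(3) ys by auto
    then show False using Cons.prems(1,2) ys grlex_less_asym by auto
  qed
  moreover have "x \<notin> set xs" "y \<notin> set ys'"
    using Cons.prems(1,2) ys grlex_less_asym by auto
  ultimately have "set xs = set ys'" using Cons.prems(3) ys by auto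
  then show ?case using Cons ys \<open>x = y\<close> by auto
qed simp

text \<open>The graded lexicographic order is a strict linear order, so the enumeration \<^const>\<open>mi_list\<close> of
  the finitely many multi-indices of bounded degree exists and is unique.\<close>

lemma mi_list_spec:
  "sorted_wrt grlex_less (mi_list m :: ('n::{finite,linorder} \<Rightarrow> nat) list)"
  "set (mi_list m :: ('n \<Rightarrow> nat) list) = {\<alpha>. mi_deg \<alpha> \<le> m}"
proof -
  let ?R = "\<lambda>xs :: ('n \<Rightarrow> nat) list. sorted_wrt grlex_less xs \<and> set xs = {\<alpha>. mi_deg \<alpha> \<le> m}"
  obtain xs where xs: "?R xs" using sorted_wrt_grlex_exists[OF finite_mi_deg] by blast
  have "?R (mi_list m)"
    unfolding mi_list_def by (rule theI[of ?R, OF xs]) (use xs sorted_wrt_grlex_unique in blast)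
  then show "sorted_wrt grlex_less (mi_list m :: ('n \<Rightarrow> nat) list)"
    "set (mi_list m :: ('n \<Rightarrow> nat) list) = {\<alpha>. mi_deg \<alpha> \<le> m}" by auto
qed

lemma distinct_mi_list: "distinct (mi_list m :: ('n::{finite,linorder} \<Rightarrow> nat) list)"
proof -
  have "distinct xs" if "sorted_wrt grlex_less xs" for xs :: "('n \<Rightarrow> nat) list"
    using that by (induction xs) (auto dest: grlex_less_asym)
  then show ?thesis using mi_list_spec(1) by blast
qed

lemma mi_pow_zero: "mi_pow \<alpha> (0 :: real ^ 'n::finite) = (if \<alpha> = (\<lambda>_. 0) then 1 else 0)"
  by (auto simp: mi_pow_def fun_eq_iff zero_power)

lemma mi_pow_zero_index [simp]: "mi_pow (\<lambda>_. 0) u = 1"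
  by (simp add: mi_pow_def)

lemma continuous_mi_pow: "continuous_on UNIV (mi_pow \<alpha>)"
  unfolding mi_pow_def by (intro continuous_intros)

lemma infnorm_le_iff: "infnorm u \<le> r \<longleftrightarrow> (\<forall>i. \<bar>u $ i\<bar> \<le> r)" for u :: "real ^ 'n::finite"
proof
  assume "\<forall>i. \<bar>u $ i\<bar> \<le> r"
  then show "infnorm u \<le> r" unfolding infnorm_cart by (intro cSup_least) auto
qed (meson component_le_infnorm_cart order_trans)

lemma mem_unit_cube_iff: "u \<in> cbox (-1) 1 \<longleftrightarrow> infnorm u \<le> 1" for u :: "real ^ 'n::finite"
  by (auto simp: infnorm_le_iff mem_box_cart abs_le_iff minus_le_iff)

lemma mem_scaled_cube_iff:
  "0 < r \<Longrightarrow> (1 / r) *\<^sub>R u \<in> cbox (-1) 1 \<longleftrightarrow> infnorm u \<le> r" for u :: "real ^ 'n::finite"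
  by (simp add: mem_unit_cube_iff infnorm_mul field_simps)

lemma infnorm_ball_eq_cbox: "{u. infnorm u \<le> r} = cbox (\<chi> i. - r) (\<chi> i. r)"
  for r :: real
  by (auto simp: infnorm_le_iff mem_box_cart abs_le_iff minus_le_iff)

lemma emeasure_infnorm_ball:
  "0 \<le> r \<Longrightarrow> emeasure lborel {u :: real ^ 'n::finite. infnorm u \<le> r} = ennreal ((2 * r) ^ CARD('n))"
proof -
  assume "0 \<le> r"
  then have "(\<chi> i. - r) \<in> cbox (\<chi> i. - r) (\<chi> i. r :: real ^ 'n)" by (auto simp: mem_box_cart)
  then have "measure lborel (cbox (\<chi> i. - r) (\<chi> i. r :: real ^ 'n)) = (2 * r) ^ CARD('n)"
    by (subst content_cbox_cart) auto
  moreover have "emeasure lborel (cbox (\<chi> i. - r) (\<chi> i. r :: real ^ 'n)) \<noteq> \<infinity>"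
    using emeasure_lborel_cbox_finite by (metis infinity_ennreal_def less_irrefl)
  ultimately show ?thesis
    unfolding infnorm_ball_eq_cbox using emeasure_eq_ennreal_measure by fastforce
qed

lemma borel_measurable_infnorm [measurable]:
  "infnorm \<in> borel_measurable (borel :: (real ^ 'n::finite) measure)"
  unfolding borel_measurable_iff_le by (simp add: infnorm_ball_eq_cbox)

lemma borel_measurable_mi_pow [measurable]:
  "mi_pow \<alpha> \<in> borel_measurable (borel :: (real ^ 'n::finite) measure)"
  by (intro borel_measurable_continuous_onI continuous_mi_pow)

lemma abs_mi_pow_le_one: "infnorm u \<le> 1 \<Longrightarrow> \<bar>mi_pow \<alpha> u\<bar> \<le> 1" for u :: "real ^ 'n::finite"
  unfolding mi_pow_def abs_prod by (intro prod_le_1) (auto simp: infnorm_le_iff power_abs power_le_one)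

section \<open>Product measures\<close>

lemma PiM_density:
  assumes "finite I" "prob_space M" and [measurable]: "r \<in> borel_measurable M"
    and "prob_space (density M r)"
  shows "PiM I (\<lambda>_. density M r) = density (PiM I (\<lambda>_. M)) (\<lambda>x. \<Prod>i\<in>I. r (x i))"
proof -
  interpret M: product_sigma_finite "\<lambda>_. M"
    using assms(2) by (intro product_sigma_finite.intro prob_space_imp_sigma_finite)
  interpret N: product_sigma_finite "\<lambda>_. density M r"
    using assms(4) by (intro product_sigma_finite.intro prob_space_imp_sigma_finite)
  show ?thesis
  proof (rule N.PiM_eqI[symmetric])
    show "sets (density (PiM I (\<lambda>_. M)) (\<lambda>x. \<Prod>i\<in>I. r (x i))) = sets (PiM I (\<lambda>_. density M r))"
      by (simp cong: sets_PiM_cong)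
  next
    fix A assume A: "\<And>i. i \<in> I \<Longrightarrow> A i \<in> sets (density M r)"
    then have [measurable]: "PiE I A \<in> sets (PiM I (\<lambda>_. M))"
      using \<open>finite I\<close> by (intro sets_PiM_I_finite) auto
    have "emeasure (density (PiM I (\<lambda>_. M)) (\<lambda>x. \<Prod>i\<in>I. r (x i))) (PiE I A)
        = (\<integral>\<^sup>+x. (\<Prod>i\<in>I. r (x i)) * indicator (PiE I A) x \<partial>PiM I (\<lambda>_. M))"
      by (intro emeasure_density) measurable
    also have "\<dots> = (\<integral>\<^sup>+x. (\<Prod>i\<in>I. r (x i) * indicator (A i) (x i)) \<partial>PiM I (\<lambda>_. M))"
    proof (intro nn_integral_cong)
      fix x assume "x \<in> space (PiM I (\<lambda>_. M))"
      then have "x \<in> PiE I A \<longleftrightarrow> (\<forall>i\<in>I. x i \<in> A i)" by (auto simp: space_PiM PiE_iff)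
      then have "indicator (PiE I A) x = (\<Prod>i\<in>I. indicator (A i) (x i) :: ennreal)"
        using \<open>finite I\<close> by (auto simp: indicator_def prod.neutral intro!: prod_zero[symmetric])
      then show "(\<Prod>i\<in>I. r (x i)) * indicator (PiE I A) x = (\<Prod>i\<in>I. r (x i) * indicator (A i) (x i))"
        by (simp add: prod.distrib)
    qed
    also have "\<dots> = (\<Prod>i\<in>I. \<integral>\<^sup>+x. r x * indicator (A i) x \<partial>M)"
      using A \<open>finite I\<close> by (intro M.product_nn_integral_prod) auto
    also have "\<dots> = (\<Prod>i\<in>I. emeasure (density M r) (A i))"
      using A by (intro prod.cong refl emeasure_density[symmetric]) auto
    finally show "emeasure (density (PiM I (\<lambda>_. M)) (\<lambda>x. \<Prod>i\<in>I. r (x i))) (PiE I A)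
        = (\<Prod>i\<in>I. emeasure (density M r) (A i))" .
  qed (rule \<open>finite I\<close>)
qed

text \<open>The cross terms vanish, as the coordinates are independent and centered.\<close>

lemma PiM_centered_square_integral:
  fixes Z :: "'a \<Rightarrow> real"
  assumes "finite I" "prob_space M" and Z: "integrable M Z" "integrable M (\<lambda>x. (Z x)\<^sup>2)"
    and mean: "(\<integral>x. Z x \<partial>M) = 0"
  shows "integrable (PiM I (\<lambda>_. M)) (\<lambda>X. (\<Sum>i\<in>I. Z (X i))\<^sup>2)"
    and "(\<integral>X. (\<Sum>i\<in>I. Z (X i))\<^sup>2 \<partial>PiM I (\<lambda>_. M)) = card I * (\<integral>x. (Z x)\<^sup>2 \<partial>M)"
proof -
  interpret prob_space M by fact
  interpret M: product_sigma_finite "\<lambda>_. M" by unfold_locales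
  have sq: "(\<Sum>i\<in>I. Z (X i))\<^sup>2 = (\<Sum>i\<in>I. \<Sum>j\<in>I. Z (X i) * Z (X j))" for X
    by (simp add: power2_eq_square sum_product)
  \<comment> \<open>A product of two coordinates is a product over all coordinates, with trivial factors elsewhere.\<close>
  define g where "g i j l = (if l = i then (if l = j then \<lambda>x. (Z x)\<^sup>2 else Z) else if l = j then Z else (\<lambda>_. 1))"
    for i j l :: 'b
  have intg: "integrable M (g i j l)" for i j l
    using Z by (auto simp: g_def)
  have prod: "Z (X i) * Z (X j) = (\<Prod>l\<in>I. g i j l (X l))" if "i \<in> I" "j \<in> I" for i j X
  proof (cases "i = j")
    case True
    have "(\<Prod>l\<in>I. g i j l (X l)) = (\<Prod>l\<in>I. if l = i then (Z (X i))\<^sup>2 else 1)"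
      using True by (intro prod.cong) (auto simp: g_def)
    then show ?thesis using True that \<open>finite I\<close> by (simp add: power2_eq_square)
  next
    case False
    have "(\<Prod>l\<in>I. g i j l (X l)) = (\<Prod>l\<in>I. (if l = i then Z (X i) else 1) * (if l = j then Z (X j) else 1))"
      using False by (intro prod.cong) (auto simp: g_def)
    then show ?thesis using that \<open>finite I\<close> by (simp add: prod.distrib)
  qed
  have int: "integrable (PiM I (\<lambda>_. M)) (\<lambda>X. Z (X i) * Z (X j))" if "i \<in> I" "j \<in> I" for i j
    unfolding prod[OF that] by (rule M.product_integrable_prod) (use \<open>finite I\<close> intg in auto)
  have val: "(\<integral>X. Z (X i) * Z (X j) \<partial>PiM I (\<lambda>_. M)) = (if i = j then \<integral>x. (Z x)\<^sup>2 \<partial>M else 0)"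
    if "i \<in> I" "j \<in> I" for i j
  proof -
    have "(\<integral>X. Z (X i) * Z (X j) \<partial>PiM I (\<lambda>_. M)) = (\<Prod>l\<in>I. \<integral>x. g i j l x \<partial>M)"
      unfolding prod[OF that] by (rule M.product_integral_prod) (use \<open>finite I\<close> intg in auto)
    also have "\<dots> = (if i = j then \<integral>x. (Z x)\<^sup>2 \<partial>M else 0)"
    proof (cases "i = j")
      case True
      have "(\<Prod>l\<in>I. \<integral>x. g i j l x \<partial>M) = (\<Prod>l\<in>I. if l = i then \<integral>x. (Z x)\<^sup>2 \<partial>M else 1)"
        using True by (intro prod.cong) (auto simp: g_def prob_space)
      then show ?thesis using True that \<open>finite I\<close> by simp
    next
      case False
      then show ?thesis
        using that mean by (auto simp: g_def intro!: prod_zero[OF \<open>finite I\<close>])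
    qed
    finally show ?thesis .
  qed
  show "integrable (PiM I (\<lambda>_. M)) (\<lambda>X. (\<Sum>i\<in>I. Z (X i))\<^sup>2)"
    unfolding sq using int by (intro Bochner_Integration.integrable_sum) auto
  show "(\<integral>X. (\<Sum>i\<in>I. Z (X i))\<^sup>2 \<partial>PiM I (\<lambda>_. M)) = card I * (\<integral>x. (Z x)\<^sup>2 \<partial>M)"
    unfolding sq using int val \<open>finite I\<close> by (simp add: Bochner_Integration.integral_sum)
qed

lemma PiM_component_integral:
  fixes Z :: "'a \<Rightarrow> real"
  assumes "prob_space M" "i \<in> I" "integrable M Z"
  shows "integrable (PiM I (\<lambda>_. M)) (\<lambda>X. Z (X i))" "(\<integral>X. Z (X i) \<partial>PiM I (\<lambda>_. M)) = (\<integral>x. Z x \<partial>M)"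
proof -
  have d: "distr (PiM I (\<lambda>_. M)) M (\<lambda>X. X i) = M"
    using distr_PiM_component[of I "\<lambda>_. M" i] assms by simp
  have [measurable]: "(\<lambda>X. X i) \<in> measurable (PiM I (\<lambda>_. M)) M" "Z \<in> borel_measurable M"
    using assms by auto
  show "integrable (PiM I (\<lambda>_. M)) (\<lambda>X. Z (X i))"
    using integrable_distr_eq[of "\<lambda>X. X i" "PiM I (\<lambda>_. M)" M Z] assms(3) d by simp
  show "(\<integral>X. Z (X i) \<partial>PiM I (\<lambda>_. M)) = (\<integral>x. Z x \<partial>M)"
    using integral_distr[of "\<lambda>X. X i" "PiM I (\<lambda>_. M)" M Z] d by simp
qed

text \<open>Bias-variance decomposition of an empirical mean; the variance of one summand is bounded by a
  bound \<open>V\<close> on its second moment.\<close>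

lemma empirical_mean_risk_le:
  fixes Y :: "'a \<Rightarrow> real"
  assumes M: "prob_space M" and [measurable]: "Y \<in> borel_measurable M"
    and bd: "\<And>x. x \<in> space M \<Longrightarrow> \<bar>Y x\<bar> \<le> B" and n: "n \<ge> 1"
    and second: "(\<integral>\<^sup>+x. ennreal ((Y x)\<^sup>2) \<partial>M) \<le> ennreal V" "0 \<le> V"
  defines "P \<equiv> PiM {1..n} (\<lambda>_. M)"
  defines "g \<equiv> (\<lambda>X. 1 / real n * (\<Sum>i=1..n. Y (X i)))"
  shows "(\<integral>\<^sup>+X. ennreal ((g X - \<theta>)\<^sup>2) \<partial>P) \<le> ennreal (((LINT X|P. g X) - \<theta>)\<^sup>2 + V / real n)"
proof -
  interpret M: prob_space M by fact
  interpret P: prob_space P unfolding P_def by (rule prob_space_PiM) (rule M)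
  have Y: "integrable M Y" by (rule M.integrable_const_bound[of _ B]) (use bd in auto)
  have Y2: "integrable M (\<lambda>x. (Y x)\<^sup>2)"
  proof (rule M.integrable_const_bound[of _ "B\<^sup>2"])
    show "AE x in M. norm ((Y x)\<^sup>2) \<le> B\<^sup>2"
      using power_mono[OF bd abs_ge_zero, of _ 2] by auto
  qed simp
  define \<mu> where "\<mu> = (\<integral>x. Y x \<partial>M)"
  define Z where "Z x = Y x - \<mu>" for x
  have Z: "integrable M Z" "(\<integral>x. Z x \<partial>M) = 0"
    using Y by (auto simp: Z_def[abs_def] \<mu>_def M.prob_space)
  have Z2: "integrable M (\<lambda>x. (Z x)\<^sup>2)" and Z2': "(\<integral>x. (Z x)\<^sup>2 \<partial>M) \<le> V"
  proof -
    have e: "(Z x)\<^sup>2 = (Y x)\<^sup>2 - 2 * \<mu> * Y x + \<mu>\<^sup>2" for x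
      by (simp add: Z_def power2_eq_square algebra_simps)
    show "integrable M (\<lambda>x. (Z x)\<^sup>2)" unfolding e using Y Y2 by auto
    have "(\<integral>x. (Z x)\<^sup>2 \<partial>M) = (\<integral>x. (Y x)\<^sup>2 \<partial>M) - \<mu>\<^sup>2"
      unfolding e using Y Y2 by (simp add: M.prob_space \<mu>_def power2_eq_square)
    also have "\<dots> \<le> (\<integral>x. (Y x)\<^sup>2 \<partial>M)" by simp
    also have "\<dots> \<le> V"
      using second nn_integral_eq_integral[OF Y2] by (simp add: ennreal_le_iff)
    finally show "(\<integral>x. (Z x)\<^sup>2 \<partial>M) \<le> V" .
  qed
  define S where "S X = (\<Sum>i\<in>{1..n}. Z (X i))" for X :: "nat \<Rightarrow> 'a"
  have comp: "integrable P (\<lambda>X. Z (X i))" "(\<integral>X. Z (X i) \<partial>P) = 0" if "i \<in> {1..n}" for i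
    using PiM_component_integral[OF M that Z(1)] Z(2) by (simp_all add: P_def)
  have S: "integrable P S" "(\<integral>X. S X \<partial>P) = 0"
    unfolding S_def using comp by (auto simp: Bochner_Integration.integral_sum intro!: Bochner_Integration.integrable_sum)
  have S2: "integrable P (\<lambda>X. (S X)\<^sup>2)" "(\<integral>X. (S X)\<^sup>2 \<partial>P) = real n * (\<integral>x. (Z x)\<^sup>2 \<partial>M)"
    using PiM_centered_square_integral[OF _ M Z(1) Z2 Z(2), of "{1..n}"] by (simp_all add: P_def S_def)
  have g: "g X = S X / real n + \<mu>" for X
    using n by (simp add: g_def S_def Z_def sum_subtractf field_simps)
  have mean: "(LINT X|P. g X) = \<mu>"
    unfolding g using S by (simp add: P.prob_space)
  have e: "(g X - \<theta>)\<^sup>2 = (S X)\<^sup>2 / (real n)\<^sup>2 + 2 * (\<mu> - \<theta>) / real n * S X + (\<mu> - \<theta>)\<^sup>2" for X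
    using n by (simp add: g power2_eq_square field_simps)
  have "integrable P (\<lambda>X. (g X - \<theta>)\<^sup>2)" unfolding e using S S2 by auto
  then have "(\<integral>\<^sup>+X. ennreal ((g X - \<theta>)\<^sup>2) \<partial>P) = ennreal (LINT X|P. (g X - \<theta>)\<^sup>2)"
    by (intro nn_integral_eq_integral) auto
  also have "(LINT X|P. (g X - \<theta>)\<^sup>2) = (\<integral>x. (Z x)\<^sup>2 \<partial>M) / real n + (\<mu> - \<theta>)\<^sup>2"
    unfolding e using S S2 n by (simp add: P.prob_space power2_eq_square)
  also have "\<dots> \<le> (\<mu> - \<theta>)\<^sup>2 + V / real n"
    using Z2' n by (simp add: divide_right_mono)
  finally show ?thesis by (simp add: mean ennreal_leI)
qed

section \<open>The local polynomial estimator as a kernel estimator\<close>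

lemma nbhd_borel [measurable]: "closed D \<Longrightarrow> nbhd D t r \<in> sets borel"
proof -
  assume "closed D"
  then have "D \<in> sets borel" by simp
  moreover have "nbhd D t r = ((\<lambda>u. t + u) -` D \<inter> space borel) \<inter> {u. infnorm u \<le> r}"
    by (auto simp: nbhd_def)
  moreover have "(\<lambda>u. t + u) -` D \<inter> space borel \<in> sets borel"
    by (rule measurable_sets[OF _ \<open>D \<in> sets borel\<close>]) simp
  ultimately show ?thesis by simp
qed

lemma kernel_wt_eq:
  assumes "0 < h"
  shows "kernel_wt D t h (u :: real ^ 'n::finite) = 1 / h ^ CARD('n) * indicator (nbhd D t h) u"
  using assms by (auto simp: kernel_wt_def indicator_def nbhd_def mem_scaled_cube_iff)

lemma borel_measurable_kernel_wt [measurable]: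
  "closed D \<Longrightarrow> 0 < h \<Longrightarrow> kernel_wt D t h \<in> borel_measurable borel"
  by (subst measurable_cong[OF kernel_wt_eq]) measurable

lemma emeasure_nbhd_le: 
  assumes "0 \<le> r" shows "emeasure lborel (nbhd D (t :: real ^ 'n::finite) r) \<le> ennreal ((2 * r) ^ CARD('n))"
proof -
  have "{u :: real ^ 'n. infnorm u \<le> r} \<in> sets lborel" by measurable
  then have "emeasure lborel (nbhd D t r) \<le> emeasure lborel {u :: real ^ 'n. infnorm u \<le> r}"
    by (intro emeasure_mono) (auto simp: nbhd_def)
  then show ?thesis using emeasure_infnorm_ball[OF assms, where 'n='n] by simp
qed

lemma integrable_mult_kernel_wt:
  fixes g :: "real ^ 'n::finite \<Rightarrow> real"
  assumes "closed D" "0 < h" and [measurable]: "g \<in> borel_measurable borel"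
    and bound: "\<And>u. u \<in> nbhd D t h \<Longrightarrow> \<bar>g u\<bar> \<le> B"
  shows "integrable lborel (\<lambda>u. g u * kernel_wt D t h u)"
proof (rule integrableI_bounded_set[of "nbhd D t h" _ _ "B * (1 / h ^ CARD('n))"])
  show "nbhd D t h \<in> sets lborel" using nbhd_borel[OF assms(1)] by simp
  show "(\<lambda>u. g u * kernel_wt D t h u) \<in> borel_measurable lborel"
    using borel_measurable_kernel_wt[OF assms(1,2)] by measurable
  show "emeasure lborel (nbhd D t h) < \<infinity>"
    using emeasure_nbhd_le[of h D t] assms(2) by (auto intro: order_le_less_trans)
  show "AE x\<in>nbhd D t h in lborel. norm (g x * kernel_wt D t h x) \<le> B * (1 / h ^ CARD('n))"
    using bound assms(2) by (auto simp: kernel_wt_eq abs_mult divide_right_mono)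
  show "AE x in lborel. x \<notin> nbhd D t h \<longrightarrow> g x * kernel_wt D t h x = 0"
    using assms(2) by (auto simp: kernel_wt_eq)
qed

lemma kernel_mass_le:
  assumes "closed D" "0 < h"
  shows "0 \<le> kernel_mass D (t :: real ^ 'n::finite) h" "kernel_mass D t h \<le> 2 ^ CARD('n)"
proof -
  have nn: "0 \<le> kernel_wt D t h u" for u using assms by (simp add: kernel_wt_eq)
  then show "0 \<le> kernel_mass D t h" unfolding kernel_mass_def by simp
  have "ennreal (kernel_mass D t h) = (\<integral>\<^sup>+u. ennreal (kernel_wt D t h u) \<partial>lborel)"
    unfolding kernel_mass_def using integrable_mult_kernel_wt[OF assms, of "\<lambda>_. 1" t 1] nn
    by (intro nn_integral_eq_integral[symmetric]) auto
  also have "\<dots> = (\<integral>\<^sup>+u. ennreal (1 / h ^ CARD('n)) * indicator (nbhd D t h) u \<partial>lborel)"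
    using assms(2) by (intro nn_integral_cong) (auto simp: kernel_wt_eq indicator_def)
  also have "\<dots> = ennreal (1 / h ^ CARD('n)) * emeasure lborel (nbhd D t h)"
    using nbhd_borel[OF assms(1)] by (intro nn_integral_cmult_indicator) auto
  also have "\<dots> \<le> ennreal (1 / h ^ CARD('n)) * ennreal ((2 * h) ^ CARD('n))"
    using assms by (intro mult_left_mono emeasure_nbhd_le) auto
  also have "\<dots> = ennreal (2 ^ CARD('n))"
    using assms(2) by (simp add: ennreal_mult[symmetric] power_mult_distrib)
  finally show "kernel_mass D t h \<le> 2 ^ CARD('n)" by (simp add: ennreal_le_iff)
qed

lemma Phi_index:
  "i < length (mi_list m :: ('n::{finite,linorder} \<Rightarrow> nat) list) \<Longrightarrow>
    vec_index (Phi m h (u :: real ^ 'n::_)) i = mi_pow (mi_list m ! i) ((1 / h) *\<^sub>R u)"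
  by (simp add: Phi_def vec_of_list_index)

lemma Phi_carrier:
  "Phi m h (u :: real ^ 'n::{finite,linorder}) \<in> carrier_vec (length (mi_list m :: ('n \<Rightarrow> nat) list))"
  by (simp add: Phi_def carrier_vecI)

lemma gram_mat_carrier:
  fixes t :: "real ^ 'n::{finite,linorder}" and m :: nat
  defines "k \<equiv> length (mi_list m :: ('n \<Rightarrow> nat) list)"
  shows "gram_mat D t m h \<in> carrier_mat k k"
  by (simp add: gram_mat_def k_def Let_def)

lemma gram_mat_index:
  fixes t :: "real ^ 'n::{finite,linorder}" and m :: nat
  defines "k \<equiv> length (mi_list m :: ('n \<Rightarrow> nat) list)"
  assumes "i < k" "j < k"
  shows "gram_mat D t m h $$ (i, j) =
    (LINT u|lborel. vec_index (Phi m h u) i * vec_index (Phi m h u) j * kernel_wt D t h u)"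
  using assms by (simp add: gram_mat_def k_def Let_def)

lemma gram_mat_quadratic_form:
  fixes t :: "real ^ 'n::{finite,linorder}" and x :: "nat \<Rightarrow> real" and m :: nat and h :: real
  defines "k \<equiv> length (mi_list m :: ('n \<Rightarrow> nat) list)"
  defines "\<psi> \<equiv> (\<lambda>u. \<Sum>i<k. x i * mi_pow (mi_list m ! i) ((1 / h) *\<^sub>R u))"
  assumes D: "closed D" and h: "0 < h"
  shows "(\<Sum>i<k. \<Sum>j<k. gram_mat D t m h $$ (i, j) * x i * x j)
    = (LINT u|lborel. (\<psi> u)\<^sup>2 * kernel_wt D t h u)"
    and "integrable lborel (\<lambda>u. (\<psi> u)\<^sup>2 * kernel_wt D t h u)"
    and "\<psi> \<in> borel_measurable borel"
    and "\<And>u. u \<in> nbhd D t h \<Longrightarrow> \<bar>\<psi> u\<bar> \<le> (\<Sum>i<k. \<bar>x i\<bar>)"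
proof -
  have small: "\<bar>mi_pow \<alpha> ((1 / h) *\<^sub>R u)\<bar> \<le> 1" if "u \<in> nbhd D t h" for u \<alpha>
    using that h by (intro abs_mi_pow_le_one) (simp add: infnorm_mul nbhd_def)
  have pow [measurable]: "(\<lambda>u. mi_pow \<alpha> ((1 / h) *\<^sub>R (u :: real ^ 'n::_))) \<in> borel_measurable borel" for \<alpha>
    by (rule measurable_compose[OF _ borel_measurable_mi_pow]) measurable
  show meas: "\<psi> \<in> borel_measurable borel" unfolding \<psi>_def by measurable
  show bound: "\<bar>\<psi> u\<bar> \<le> (\<Sum>i<k. \<bar>x i\<bar>)" if "u \<in> nbhd D t h" for u
    unfolding \<psi>_def using small[OF that]
    by (intro order_trans[OF sum_abs] sum_mono) (simp add: abs_mult mult_left_le)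
  show "integrable lborel (\<lambda>u. (\<psi> u)\<^sup>2 * kernel_wt D t h u)"
  proof (rule integrable_mult_kernel_wt[OF D h])
    show "\<bar>(\<psi> u)\<^sup>2\<bar> \<le> (\<Sum>i<k. \<bar>x i\<bar>)\<^sup>2" if "u \<in> nbhd D t h" for u
      using power_mono[OF bound[OF that] abs_ge_zero, of 2] by simp
  qed (use meas in measurable)
  let ?p = "\<lambda>i u. mi_pow (mi_list m ! i) ((1 / h) *\<^sub>R (u :: real ^ 'n::_))"
  have int: "integrable lborel (\<lambda>u. ?p i u * ?p j u * kernel_wt D t h u)" for i j
  proof (rule integrable_mult_kernel_wt[OF D h])
    show "\<bar>?p i u * ?p j u\<bar> \<le> 1" if "u \<in> nbhd D t h" for u
      using small[OF that] by (simp add: abs_mult mult_le_one)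
  qed measurable
  have "(\<psi> u)\<^sup>2 * kernel_wt D t h u
    = (\<Sum>i<k. \<Sum>j<k. x i * x j * (?p i u * ?p j u * kernel_wt D t h u))" for u
    unfolding \<psi>_def power2_eq_square sum_product sum_distrib_right
    by (intro sum.cong refl) (simp add: sum_distrib_left mult_ac)
  then have "(LINT u|lborel. (\<psi> u)\<^sup>2 * kernel_wt D t h u)
    = (\<Sum>i<k. \<Sum>j<k. x i * x j * (LINT u|lborel. ?p i u * ?p j u * kernel_wt D t h u))"
    using int by (simp add: Bochner_Integration.integral_sum Bochner_Integration.integrable_sum)
  also have "\<dots> = (\<Sum>i<k. \<Sum>j<k. gram_mat D t m h $$ (i, j) * x i * x j)"
    by (intro sum.cong refl) (simp add: gram_mat_index Phi_index k_def)
  finally show "(\<Sum>i<k. \<Sum>j<k. gram_mat D t m h $$ (i, j) * x i * x j)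
    = (LINT u|lborel. (\<psi> u)\<^sup>2 * kernel_wt D t h u)" by simp
qed

lemma gram_mat_sym:
  fixes t :: "real ^ 'n::{finite,linorder}" and m :: nat
  defines "k \<equiv> length (mi_list m :: ('n \<Rightarrow> nat) list)"
  assumes "i < k" "j < k"
  shows "gram_mat D t m h $$ (i, j) = gram_mat D t m h $$ (j, i)"
  using assms by (simp add: gram_mat_index mult.commute k_def)

lemma zero_index_in_mi_list:
  obtains i where "i < length (mi_list m :: ('n::{finite,linorder} \<Rightarrow> nat) list)"
    "mi_list m ! i = (\<lambda>_ :: 'n. 0)"
proof -
  have "(\<lambda>_. 0) \<in> set (mi_list m :: ('n \<Rightarrow> nat) list)" by (simp add: mi_list_spec mi_deg_def)
  then show ?thesis using that by (auto simp: in_set_conv_nth)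
qed

lemma min_eigenvalue_gram_le:
  fixes t :: "real ^ 'n::{finite,linorder}"
  assumes D: "closed D" and h: "0 < h"
  shows "min_eigenvalue (gram_mat D t m h) \<le> kernel_mass D t h"
proof -
  let ?k = "length (mi_list m :: ('n \<Rightarrow> nat) list)"
  obtain i where i: "i < ?k" "mi_list m ! i = (\<lambda>_ :: 'n. 0)" using zero_index_in_mi_list .
  \<comment> \<open>Evaluate the quadratic form at the unit vector of the constant monomial.\<close>
  let ?x = "\<lambda>j. if j = i then 1 else 0 :: real"
  have "min_eigenvalue (gram_mat D t m h) * (\<Sum>j<?k. (?x j)\<^sup>2)
      \<le> (\<Sum>i<?k. \<Sum>j<?k. gram_mat D t m h $$ (i, j) * ?x i * ?x j)"
    using i by (intro min_eigenvalue_le_quadratic_form gram_mat_carrier gram_mat_sym) auto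
  also have "\<dots> = (LINT u|lborel. (\<Sum>j<?k. ?x j * mi_pow (mi_list m ! j) ((1 / h) *\<^sub>R u))\<^sup>2 * kernel_wt D t h u)"
    by (rule gram_mat_quadratic_form(1)[OF D h])
  also have "(\<lambda>u :: real ^ 'n::_. \<Sum>j<?k. ?x j * mi_pow (mi_list m ! j) ((1 / h) *\<^sub>R u)) = (\<lambda>u. 1)"
  proof
    fix u :: "real ^ 'n::_"
    have "(\<Sum>j<?k. ?x j * mi_pow (mi_list m ! j) ((1 / h) *\<^sub>R u))
        = (\<Sum>j<?k. if j = i then mi_pow (mi_list m ! i) ((1 / h) *\<^sub>R u) else 0)"
      by (intro sum.cong) auto
    moreover have "mi_pow (mi_list m ! i) ((1 / h) *\<^sub>R u) = 1"
      by (subst i(2)) (rule mi_pow_zero_index)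
    ultimately show "(\<Sum>j<?k. ?x j * mi_pow (mi_list m ! j) ((1 / h) *\<^sub>R u)) = 1" using i by simp
  qed
  finally show ?thesis using i(1) by (simp add: kernel_mass_def if_distrib[of "\<lambda>x. x^2"] cong: if_cong)
qed

lemma sum_mi_pow_zero_squared:
  "(\<Sum>i<length (mi_list m :: ('n::{finite,linorder} \<Rightarrow> nat) list).
      (mi_pow (mi_list m ! i) (0 :: real ^ 'n::_))\<^sup>2) = 1"
proof -
  let ?xs = "mi_list m :: ('n \<Rightarrow> nat) list"
  have "(\<Sum>i<length ?xs. (mi_pow (?xs ! i) (0 :: real ^ 'n::_))\<^sup>2) = (\<Sum>\<alpha>\<in>set ?xs. (mi_pow \<alpha> (0 :: real ^ 'n::_))\<^sup>2)"
    by (rule sum.reindex_bij_betw[OF bij_betw_nth[OF distinct_mi_list refl refl]])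
  also have "\<dots> = (\<Sum>\<alpha>\<in>set ?xs. if \<alpha> = (\<lambda>_. 0) then 1 else 0)"
    by (intro sum.cong) (auto simp: mi_pow_zero)
  also have "\<dots> = 1" 
    by (subst mi_list_spec(2), subst sum.delta[OF finite_mi_deg]) (simp add: mi_deg_def)
  finally show ?thesis .
qed

text \<open>
  The local polynomial estimator is a kernel estimator, whose weight \<open>\<psi>\<close> is the polynomial
  \<open>v\<^sup>T\<Phi>(u)\<close> with \<open>Bv = \<Phi>(0)\<close>, where \<open>B\<close> is the Gram matrix. Its second moment \<open>\<tau>\<close> equals
  \<open>v\<^sup>TBv = v\<^sup>T\<Phi>(0)\<close>. Since \<open>\<Phi>(0)\<close> is a unit vector, \<open>\<tau>\<^sup>2 \<le> \<bar>v\<bar>\<^sup>2 \<le> v\<^sup>TBv / lam = \<tau> / lam\<close>.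
\<close>

lemma lp_estimator_representation:
  fixes t :: "real ^ 'n::{finite,linorder}"
  assumes D: "closed D" and h: "0 < h" and lam: "0 < lam" "lam \<le> min_eigenvalue (gram_mat D t m h)"
  obtains \<psi> B where "\<psi> \<in> borel_measurable borel" "\<And>u. u \<in> nbhd D t h \<Longrightarrow> \<bar>\<psi> u\<bar> \<le> B"
    "\<And>n X. lp_estimator D t m h n X = 1 / real n * (\<Sum>i=1..n. \<psi> (X i - t) * kernel_wt D t h (X i - t))"
    "integrable lborel (\<lambda>u. (\<psi> u)\<^sup>2 * kernel_wt D t h u)"
    "(LINT u|lborel. (\<psi> u)\<^sup>2 * kernel_wt D t h u) \<le> 1 / lam"
proof -
  define k where "k = length (mi_list m :: ('n \<Rightarrow> nat) list)"
  define A where "A = gram_mat D t m h"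
  have k: "0 < k" using zero_index_in_mi_list k_def by (metis gr_zeroI not_less_zero)
  have A: "A \<in> carrier_mat k k" using gram_mat_carrier by (simp add: A_def k_def)
  have sym: "A $$ (i, j) = A $$ (j, i)" if "i < k" "j < k" for i j
    using gram_mat_sym that by (simp add: A_def k_def)
  have low: "lam * (\<Sum>i<k. (x i)\<^sup>2) \<le> (\<Sum>i<k. \<Sum>j<k. A $$ (i, j) * x i * x j)" for x
  proof -
    have "lam * (\<Sum>i<k. (x i)\<^sup>2) \<le> min_eigenvalue A * (\<Sum>i<k. (x i)\<^sup>2)"
      using lam(2) by (intro mult_right_mono sum_nonneg) (auto simp: A_def)
    also have "\<dots> \<le> (\<Sum>i<k. \<Sum>j<k. A $$ (i, j) * x i * x j)"
      by (rule min_eigenvalue_le_quadratic_form[OF A sym k])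
    finally show ?thesis .
  qed
  have pos: "0 < (\<Sum>i<k. \<Sum>j<k. A $$ (i, j) * x i * x j)" if nz: "\<exists>i<k. x i \<noteq> 0" for x
  proof -
    obtain i where "i < k" "x i \<noteq> 0" using nz by blast
    then have "0 < (\<Sum>i<k. (x i)\<^sup>2)" by (intro sum_pos2[of _ i]) auto
    then show ?thesis using low[of x] lam(1) by (meson less_le_trans mult_pos_pos)
  qed
  have Phi0: "Phi m h (0 :: real ^ 'n::_) \<in> carrier_vec k" using Phi_carrier by (simp add: k_def)
  have "\<exists>v\<in>carrier_vec k. A *\<^sub>v v = Phi m h (0 :: real ^ 'n::_) \<and> (\<forall>y\<in>carrier_vec k.
      scalar_prod (the (mat_inverse (cholesky A)) *\<^sub>v Phi m h (0 :: real ^ 'n::_)) (the (mat_inverse (cholesky A)) *\<^sub>v y)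
      = scalar_prod v y)"
    by (rule cholesky_inverse_scalar_prod[OF A _ _ Phi0]) (fact sym, fact pos)
  then obtain v where v: "v \<in> carrier_vec k" "A *\<^sub>v v = Phi m h (0 :: real ^ 'n::_)"
    "\<And>y. y \<in> carrier_vec k \<Longrightarrow>
      scalar_prod (the (mat_inverse (cholesky A)) *\<^sub>v Phi m h (0 :: real ^ 'n::_)) (the (mat_inverse (cholesky A)) *\<^sub>v y)
      = scalar_prod v y" by blast
  define x where "x i = vec_index v i" for i
  define \<psi> where "\<psi> u = (\<Sum>i<k. x i * mi_pow (mi_list m ! i) ((1 / h) *\<^sub>R (u :: real ^ 'n::_)))" for u
  have vPhi: "scalar_prod v (Phi m h u) = \<psi> u" for u
    using Phi_carrier[of m h u]
    by (auto simp: scalar_prod_def \<psi>_def x_def k_def Phi_index atLeast0LessThan intro!: sum.cong)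
  have est: "lp_estimator D t m h n X = 1 / real n * (\<Sum>i=1..n. \<psi> (X i - t) * kernel_wt D t h (X i - t))" for n X
  proof -
    have "scalar_prod (H_vec D t m h 0) (H_vec D t m h u) = \<psi> u" for u
      unfolding H_vec_def A_def[symmetric] using v(3)[of "Phi m h u"] Phi_carrier[of m h u] vPhi[of u]
      by (simp add: k_def)
    then show ?thesis by (simp add: lp_estimator_def)
  qed
  define \<tau> where "\<tau> = (LINT u|lborel. (\<psi> u)\<^sup>2 * kernel_wt D t h u)"
  have q: "(\<Sum>i<k. \<Sum>j<k. A $$ (i, j) * x i * x j) = \<tau>"
    unfolding \<tau>_def \<psi>_def k_def A_def by (rule gram_mat_quadratic_form(1)[OF D h])
  have "(\<Sum>i<k. \<Sum>j<k. A $$ (i, j) * x i * x j) = (\<Sum>i<k. x i * vec_index (A *\<^sub>v v) i)"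
    using A v(1) by (intro sum.cong refl) (auto simp: scalar_prod_def x_def atLeast0LessThan sum_distrib_left mult_ac)
  also have "\<dots> = (\<Sum>i<k. x i * mi_pow (mi_list m ! i) (0 :: real ^ 'n::_))"
    unfolding v(2) by (intro sum.cong refl) (simp add: Phi_index k_def)
  finally have "\<tau>\<^sup>2 = (\<Sum>i<k. x i * mi_pow (mi_list m ! i) (0 :: real ^ 'n::_))\<^sup>2" using q by simp
  also have "\<dots> \<le> (\<Sum>i<k. (x i)\<^sup>2) * (\<Sum>i<k. (mi_pow (mi_list m ! i) (0 :: real ^ 'n::_))\<^sup>2)"
    by (rule Cauchy_Schwarz_ineq_sum)
  also have "\<dots> = (\<Sum>i<k. (x i)\<^sup>2)" using sum_mi_pow_zero_squared[of m, where 'n='n] by (simp add: k_def)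
  finally have "\<tau>\<^sup>2 \<le> (\<Sum>i<k. (x i)\<^sup>2)" .
  then have "lam * \<tau>\<^sup>2 \<le> lam * (\<Sum>i<k. (x i)\<^sup>2)" using lam(1) by simp
  also have "\<dots> \<le> \<tau>" using low[of x] q by simp
  finally have "lam * \<tau>\<^sup>2 \<le> \<tau>" .
  then have "\<tau> * (lam * \<tau>) \<le> \<tau> * 1" by (simp add: power2_eq_square mult_ac)
  have "\<tau> \<le> 1 / lam"
  proof (cases "0 < \<tau>")
    case True
    then have "lam * \<tau> \<le> 1" using \<open>\<tau> * (lam * \<tau>) \<le> \<tau> * 1\<close> mult_le_cancel_left_pos by blast
    then show ?thesis using lam(1) by (simp add: field_simps)
  next
    case False
    then have "\<tau> \<le> 0" by simp
    also have "0 \<le> 1 / lam" using lam(1) by simp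
    finally show ?thesis .
  qed
  moreover have "\<psi> \<in> borel_measurable borel"
    unfolding \<psi>_def k_def by (rule gram_mat_quadratic_form(3)[OF D h])
  moreover have "integrable lborel (\<lambda>u. (\<psi> u)\<^sup>2 * kernel_wt D t h u)"
    unfolding \<psi>_def k_def by (rule gram_mat_quadratic_form(2)[OF D h])
  moreover have "\<bar>\<psi> u\<bar> \<le> (\<Sum>i<k. \<bar>x i\<bar>)" if "u \<in> nbhd D t h" for u
    unfolding \<psi>_def k_def by (rule gram_mat_quadratic_form(4)[OF D h that])
  ultimately show thesis using that[of \<psi> "\<Sum>i<k. \<bar>x i\<bar>"] est unfolding \<tau>_def by blast
qed

section \<open>Risk of the local polynomial estimator\<close>

lemma sets_law [simp, measurable_cong]: "sets (law D f) = sets borel"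
  by (simp add: law_def)

lemma borel_measurable_density:
  assumes "closed D" "is_density_on D f"
  shows "(\<lambda>x. ennreal (f x) * indicator D x) \<in> borel_measurable borel"
proof -
  have "(\<lambda>x. indicator D x *\<^sub>R f x) \<in> borel_measurable borel"
    using assms borel_measurable_restrict_space_iff[of D borel f] by (simp add: is_density_on_def)
  then have "(\<lambda>x. ennreal (indicator D x *\<^sub>R f x)) \<in> borel_measurable borel" by measurable
  also have "(\<lambda>x. ennreal (indicator D x *\<^sub>R f x)) = (\<lambda>x. ennreal (f x) * indicator D x)"
    by (auto simp: indicator_def)
  finally show ?thesis .
qed

lemma prob_space_law:
  assumes "closed D" "is_density_on D f"
  shows "prob_space (law D f)"
proof (rule prob_spaceI)
  have "emeasure (law D f) (space (law D f)) = (\<integral>\<^sup>+x\<in>D. ennreal (f x) \<partial>lborel)"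
    using borel_measurable_density[OF assms] by (simp add: law_def emeasure_density)
  then show "emeasure (law D f) (space (law D f)) = 1" using assms(2) by (simp add: is_density_on_def)
qed

lemma nn_integral_law:
  assumes "closed D" "is_density_on D f" "g \<in> borel_measurable borel"
  shows "(\<integral>\<^sup>+x. g x \<partial>law D f) = (\<integral>\<^sup>+x. ennreal (f x) * indicator D x * g x \<partial>lborel)"
  unfolding law_def using borel_measurable_density[OF assms(1,2)] assms(3)
  by (intro nn_integral_density) auto

lemma kernel_estimate_second_moment:
  fixes t :: "real ^ 'n::finite"
  assumes D: "closed D" and f: "is_density_on D f" and h: "0 < h"
    and sup: "\<And>u. u \<in> nbhd D t h \<Longrightarrow> f (t + u) \<le> c" and "0 \<le> c"
    and \<psi> [measurable]: "\<psi> \<in> borel_measurable borel"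
    and int: "integrable lborel (\<lambda>u. (\<psi> u)\<^sup>2 * kernel_wt D t h u)"
    and \<tau>: "(LINT u|lborel. (\<psi> u)\<^sup>2 * kernel_wt D t h u) \<le> \<tau>"
  shows "(\<integral>\<^sup>+x. ennreal ((\<psi> (x - t) * kernel_wt D t h (x - t))\<^sup>2) \<partial>law D f)
    \<le> ennreal (c / h ^ CARD('n) * \<tau>)"
proof -
  note [measurable] = borel_measurable_kernel_wt[OF D h, of t]
  have nn: "0 \<le> kernel_wt D t h u" for u using h by (simp add: kernel_wt_eq)
  define k where "k = c / h ^ CARD('n)"
  have k: "0 \<le> k" using h \<open>0 \<le> c\<close> by (simp add: k_def)
  have "(\<integral>\<^sup>+x. ennreal ((\<psi> (x - t) * kernel_wt D t h (x - t))\<^sup>2) \<partial>law D f)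
    = (\<integral>\<^sup>+x. ennreal (f x) * indicator D x * ennreal ((\<psi> (x - t) * kernel_wt D t h (x - t))\<^sup>2) \<partial>lborel)"
    by (rule nn_integral_law[OF D f]) measurable
  also have "\<dots> \<le> (\<integral>\<^sup>+x. ennreal (k * ((\<psi> (x - t))\<^sup>2 * kernel_wt D t h (x - t))) \<partial>lborel)"
  proof (intro nn_integral_mono)
    fix x
    show "ennreal (f x) * indicator D x * ennreal ((\<psi> (x - t) * kernel_wt D t h (x - t))\<^sup>2)
      \<le> ennreal (k * ((\<psi> (x - t))\<^sup>2 * kernel_wt D t h (x - t)))"
    proof (cases "x - t \<in> nbhd D t h")
      case True
      then have x: "x \<in> D" by (simp add: nbhd_def)
      have "0 \<le> f x" using f x by (simp add: is_density_on_def)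
      have "f x \<le> c" using sup[OF True] by simp
      then have "f x * (\<psi> (x - t) * (1 / h ^ CARD('n)))\<^sup>2 \<le> c * (\<psi> (x - t) * (1 / h ^ CARD('n)))\<^sup>2"
        by (intro mult_right_mono) auto
      also have "\<dots> = k * ((\<psi> (x - t))\<^sup>2 * (1 / h ^ CARD('n)))"
        by (simp add: k_def power2_eq_square)
      finally show ?thesis
        using True x \<open>0 \<le> f x\<close> by (simp add: kernel_wt_eq[OF h] ennreal_mult[symmetric] ennreal_leI)
    qed (simp add: kernel_wt_eq[OF h])
  qed
  also have "\<dots> = (\<integral>\<^sup>+x. ennreal (k * ((\<psi> (t + x - t))\<^sup>2 * kernel_wt D t h (t + x - t))) \<partial>lborel)"
    by (subst (1) lborel_distr_plus[symmetric, of t], subst nn_integral_distr) auto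
  also have "\<dots> = ennreal (LINT u|lborel. k * ((\<psi> u)\<^sup>2 * kernel_wt D t h u))"
    using int k nn by (subst nn_integral_eq_integral) auto
  also have "\<dots> \<le> ennreal (k * \<tau>)"
    using int k \<tau> by (intro ennreal_leI) (simp add: mult_left_mono)
  finally show ?thesis by (simp add: k_def)
qed

text \<open>The squared bias is kept as it stands; the variance is at most \<open>c / (n h\<^sup>d lam)\<close>.\<close>

lemma lp_estimator_risk:
  fixes t :: "real ^ 'n::{finite,linorder}"
  assumes D: "closed D" and f: "is_density_on D f" and h: "0 < h" and n: "n \<ge> 1"
    and lam: "0 < lam" "lam \<le> min_eigenvalue (gram_mat D t m h)"
    and sup: "\<And>u. u \<in> nbhd D t h \<Longrightarrow> f (t + u) \<le> c" and "0 \<le> c"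
  shows "(\<integral>\<^sup>+X. ennreal ((lp_estimator D t m h n X - \<theta>)\<^sup>2) \<partial>sample_law D n f)
    \<le> ennreal (((LINT X|sample_law D n f. lp_estimator D t m h n X) - \<theta>)\<^sup>2
        + c / (real n * h ^ CARD('n) * lam))"
proof -
  obtain \<psi> B where \<psi>: "\<psi> \<in> borel_measurable borel" "\<And>u. u \<in> nbhd D t h \<Longrightarrow> \<bar>\<psi> u\<bar> \<le> B"
    "\<And>n X. lp_estimator D t m h n X = 1 / real n * (\<Sum>i=1..n. \<psi> (X i - t) * kernel_wt D t h (X i - t))"
    "integrable lborel (\<lambda>u. (\<psi> u)\<^sup>2 * kernel_wt D t h u)"
    "(LINT u|lborel. (\<psi> u)\<^sup>2 * kernel_wt D t h u) \<le> 1 / lam"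
    using lp_estimator_representation[OF D h lam, of thesis] by blast
  note [measurable] = borel_measurable_kernel_wt[OF D h, of t] \<psi>(1)
  let ?Y = "\<lambda>x. \<psi> (x - t) * kernel_wt D t h (x - t)"
  have nn: "0 \<le> kernel_wt D t h u" for u using h by (simp add: kernel_wt_eq)
  have bd: "\<bar>?Y x\<bar> \<le> \<bar>B\<bar> * (1 / h ^ CARD('n))" for x
  proof (cases "x - t \<in> nbhd D t h")
    case True
    then show ?thesis using \<psi>(2)[OF True] h
      by (auto simp: kernel_wt_eq abs_mult intro!: divide_right_mono)
  qed (use h in \<open>simp add: kernel_wt_eq\<close>)
  have "(\<integral>\<^sup>+X. ennreal ((1 / real n * (\<Sum>i=1..n. ?Y (X i)) - \<theta>)\<^sup>2) \<partial>PiM {1..n} (\<lambda>_. law D f))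
    \<le> ennreal (((LINT X|PiM {1..n} (\<lambda>_. law D f). 1 / real n * (\<Sum>i=1..n. ?Y (X i))) - \<theta>)\<^sup>2
      + (c / h ^ CARD('n) * (1 / lam)) / real n)"
  proof (rule empirical_mean_risk_le[OF prob_space_law[OF D f] _ bd n])
    show "?Y \<in> borel_measurable (law D f)" by measurable
    show "(\<integral>\<^sup>+x. ennreal ((?Y x)\<^sup>2) \<partial>law D f) \<le> ennreal (c / h ^ CARD('n) * (1 / lam))"
      by (rule kernel_estimate_second_moment[OF D f h sup \<open>0 \<le> c\<close> \<psi>(1,4,5)])
    show "0 \<le> c / h ^ CARD('n) * (1 / lam)" using h lam \<open>0 \<le> c\<close> by simp
  qed
  then show ?thesis by (simp add: \<psi>(3) sample_law_def mult_ac)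
qed

lemma lp_estimator_measurable:
  fixes t :: "real ^ 'n::{finite,linorder}"
  assumes D: "closed D" and h: "0 < h"
    and lam: "0 < lam" "lam \<le> min_eigenvalue (gram_mat D t m h)"
  shows "lp_estimator D t m h n \<in> estimators n"
proof -
  obtain \<psi> B where \<psi>: "\<psi> \<in> borel_measurable borel" "\<And>u. u \<in> nbhd D t h \<Longrightarrow> \<bar>\<psi> u\<bar> \<le> B"
    "\<And>n X. lp_estimator D t m h n X = 1 / real n * (\<Sum>i=1..n. \<psi> (X i - t) * kernel_wt D t h (X i - t))"
    "integrable lborel (\<lambda>u. (\<psi> u)\<^sup>2 * kernel_wt D t h u)"
    "(LINT u|lborel. (\<psi> u)\<^sup>2 * kernel_wt D t h u) \<le> 1 / lam"
    using lp_estimator_representation[OF D h lam, of thesis] by blast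
  note [measurable] = borel_measurable_kernel_wt[OF D h, of t] \<psi>(1)
  show ?thesis unfolding estimators_def \<psi>(3)[abs_def] by measurable
qed

section \<open>Lower bound by two hypotheses\<close>

lemma ennreal_sqrt_le_imp_le_square: "ennreal_sqrt x \<le> y \<Longrightarrow> x \<le> y\<^sup>2"
proof (cases "x = \<infinity>")
  case True
  assume "ennreal_sqrt x \<le> y"
  then have "y = \<infinity>" using True by (simp add: ennreal_sqrt_def top_unique)
  then show ?thesis by simp
next
  case False
  assume le: "ennreal_sqrt x \<le> y"
  obtain a where a: "x = ennreal a" "0 \<le> a" using False by (cases x) auto
  show ?thesis
  proof (cases y)
    case (real b)
    then have "sqrt a \<le> b" using le a by (simp add: ennreal_sqrt_def ennreal_le_iff)
    then have "a \<le> b\<^sup>2" using real(2) by (simp add: real_sqrt_le_iff' sqrt_le_D)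
    then show ?thesis using real a by (simp add: ennreal_power ennreal_leI)
  qed simp
qed

lemma ennreal_sqrt_le: "0 \<le> b \<Longrightarrow> x \<le> ennreal (b\<^sup>2) \<Longrightarrow> ennreal_sqrt x \<le> ennreal b"
proof -
  assume b: "0 \<le> b" and le: "x \<le> ennreal (b\<^sup>2)"
  then have "x \<noteq> \<infinity>" by (auto simp: top_unique)
  then obtain a where a: "x = ennreal a" "0 \<le> a" by (cases x) auto
  then have "a \<le> b\<^sup>2" using le by (simp add: ennreal_le_iff)
  then show ?thesis using a b by (simp add: ennreal_sqrt_def ennreal_leI real_le_lsqrt)
qed

text \<open>
  Le Cam's two-point bound, with the distance between the two laws measured by the second moment of
  their likelihood ratio.
\<close>

lemma two_point_risk_lower_bound:
  fixes p g :: "'a \<Rightarrow> real" and R :: ennreal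
  assumes [measurable]: "p \<in> borel_measurable P" "g \<in> borel_measurable P"
    and p: "\<And>x. 0 \<le> p x" "(\<integral>\<^sup>+x. ennreal (p x) \<partial>P) = 1"
    and B: "0 < B" "(\<integral>\<^sup>+x. ennreal ((p x)\<^sup>2) \<partial>P) \<le> ennreal B"
    and \<delta>: "0 < \<delta>" "\<delta> \<le> \<bar>\<theta>1 - \<theta>0\<bar>"
    and R0: "(\<integral>\<^sup>+x. ennreal ((g x - \<theta>0)\<^sup>2) \<partial>P) \<le> R"
    and R1: "(\<integral>\<^sup>+x. ennreal ((g x - \<theta>1)\<^sup>2) \<partial>density P (\<lambda>x. ennreal (p x))) \<le> R"
  shows "ennreal (\<delta>\<^sup>2 / 2) \<le> ennreal (1 + B) * R"
proof -
  \<comment> \<open>The weights in the two applications of \<open>2xy \<le> x\<^sup>2 + y\<^sup>2\<close> are such that, after integration, half of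
    \<open>\<delta>\<^sup>2\<close> is absorbed.\<close>
  have pt: "\<delta>\<^sup>2 * p x \<le> \<delta>\<^sup>2 / 4 * p x + p x * (g x - \<theta>1)\<^sup>2 + (\<delta>\<^sup>2 / (4 * B) * (p x)\<^sup>2 + B * (g x - \<theta>0)\<^sup>2)" for x
  proof -
    let ?y0 = "\<bar>g x - \<theta>0\<bar>" and ?y1 = "\<bar>g x - \<theta>1\<bar>"
    have "\<delta> * \<delta> \<le> \<delta> * (?y0 + ?y1)" using \<delta> by (intro mult_left_mono) auto
    then have "\<delta>\<^sup>2 * p x \<le> (\<delta> * ?y1) * p x + (\<delta> * p x) * ?y0"
      using mult_right_mono[OF _ p(1)[of x]] by (fastforce simp: power2_eq_square algebra_simps)
    also have "(\<delta> * ?y1) * p x \<le> (\<delta>\<^sup>2 / 4 + (g x - \<theta>1)\<^sup>2) * p x"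
    proof (rule mult_right_mono[OF _ p(1)])
      have "0 \<le> (\<delta> / 2 - ?y1)\<^sup>2" by simp
      then show "\<delta> * ?y1 \<le> \<delta>\<^sup>2 / 4 + (g x - \<theta>1)\<^sup>2"
        unfolding power2_diff power2_abs by (simp add: power_divide)
    qed
    also have "(\<delta> * p x) * ?y0 \<le> \<delta>\<^sup>2 / (4 * B) * (p x)\<^sup>2 + B * (g x - \<theta>0)\<^sup>2"
    proof -
      have "0 \<le> (\<delta> * p x - 2 * B * ?y0)\<^sup>2 / (4 * B)" using B by simp
      also have "\<dots> = \<delta>\<^sup>2 / (4 * B) * (p x)\<^sup>2 + B * (g x - \<theta>0)\<^sup>2 - (\<delta> * p x) * ?y0"
        unfolding power2_diff power_mult_distrib power2_abs using B(1)
        by (simp add: field_simps power2_eq_square)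
      finally show ?thesis by simp
    qed
    finally show ?thesis by (simp add: algebra_simps)
  qed
  have "ennreal (\<delta>\<^sup>2) = (\<integral>\<^sup>+x. ennreal (\<delta>\<^sup>2) * ennreal (p x) \<partial>P)"
    using p by (simp add: nn_integral_cmult)
  also have "\<dots> \<le> (\<integral>\<^sup>+x. (ennreal (\<delta>\<^sup>2 / 4) * ennreal (p x) + ennreal (p x) * ennreal ((g x - \<theta>1)\<^sup>2))
      + (ennreal (\<delta>\<^sup>2 / (4 * B)) * ennreal ((p x)\<^sup>2) + ennreal B * ennreal ((g x - \<theta>0)\<^sup>2)) \<partial>P)"
  proof (intro nn_integral_mono)
    fix x
    show "ennreal (\<delta>\<^sup>2) * ennreal (p x) \<le> (ennreal (\<delta>\<^sup>2 / 4) * ennreal (p x) + ennreal (p x) * ennreal ((g x - \<theta>1)\<^sup>2))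
      + (ennreal (\<delta>\<^sup>2 / (4 * B)) * ennreal ((p x)\<^sup>2) + ennreal B * ennreal ((g x - \<theta>0)\<^sup>2))"
      (is "_ \<le> ?r")
    proof -
      have "?r = ennreal (\<delta>\<^sup>2 / 4 * p x + p x * (g x - \<theta>1)\<^sup>2 + (\<delta>\<^sup>2 / (4 * B) * (p x)\<^sup>2 + B * (g x - \<theta>0)\<^sup>2))"
        using p(1)[of x] B(1)
        by (simp add: ennreal_mult[symmetric] ennreal_plus[symmetric] del: ennreal_plus)
      then show ?thesis
        using ennreal_leI[OF pt[of x]] p(1)[of x] by (simp add: ennreal_mult)
    qed
  qed
  also have "\<dots> = ennreal (\<delta>\<^sup>2 / 4) * (\<integral>\<^sup>+x. ennreal (p x) \<partial>P) + (\<integral>\<^sup>+x. ennreal (p x) * ennreal ((g x - \<theta>1)\<^sup>2) \<partial>P)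
      + (ennreal (\<delta>\<^sup>2 / (4 * B)) * (\<integral>\<^sup>+x. ennreal ((p x)\<^sup>2) \<partial>P) + ennreal B * (\<integral>\<^sup>+x. ennreal ((g x - \<theta>0)\<^sup>2) \<partial>P))"
    by (simp add: nn_integral_add nn_integral_cmult)
  also have "(\<integral>\<^sup>+x. ennreal (p x) * ennreal ((g x - \<theta>1)\<^sup>2) \<partial>P)
      = (\<integral>\<^sup>+x. ennreal ((g x - \<theta>1)\<^sup>2) \<partial>density P (\<lambda>x. ennreal (p x)))"
    by (rule nn_integral_density[symmetric]) measurable
  also have "ennreal (\<delta>\<^sup>2 / 4) * (\<integral>\<^sup>+x. ennreal (p x) \<partial>P) + (\<integral>\<^sup>+x. ennreal ((g x - \<theta>1)\<^sup>2) \<partial>density P (\<lambda>x. ennreal (p x)))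
      + (ennreal (\<delta>\<^sup>2 / (4 * B)) * (\<integral>\<^sup>+x. ennreal ((p x)\<^sup>2) \<partial>P) + ennreal B * (\<integral>\<^sup>+x. ennreal ((g x - \<theta>0)\<^sup>2) \<partial>P))
    \<le> ennreal (\<delta>\<^sup>2 / 4) * 1 + R + (ennreal (\<delta>\<^sup>2 / (4 * B)) * ennreal B + ennreal B * R)"
    unfolding p(2) using B R0 R1 by (intro add_mono mult_left_mono order_refl) auto
  finally have le: "ennreal (\<delta>\<^sup>2) \<le> ennreal (\<delta>\<^sup>2 / 4) * 1 + R + (ennreal (\<delta>\<^sup>2 / (4 * B)) * ennreal B + ennreal B * R)" .
  show ?thesis
  proof (cases R)
    case (real r)
    have "ennreal (\<delta>\<^sup>2) \<le> ennreal (\<delta>\<^sup>2 / 4 + r + (\<delta>\<^sup>2 / (4 * B) * B + B * r))"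
      using le B real by (simp add: ennreal_mult[symmetric] ennreal_plus[symmetric] del: ennreal_plus)
    then have "\<delta>\<^sup>2 \<le> \<delta>\<^sup>2 / 4 + r + (\<delta>\<^sup>2 / (4 * B) * B + B * r)"
      using B real by (subst (asm) ennreal_le_iff) auto
    then have "\<delta>\<^sup>2 / 2 \<le> (1 + B) * r" using B by (simp add: field_simps)
    then have "ennreal (\<delta>\<^sup>2 / 2) \<le> ennreal ((1 + B) * r)" by (rule ennreal_leI)
    then show ?thesis using real B by (simp add: ennreal_mult)
  next
    case top
    then show ?thesis using B by (simp add: ennreal_mult_top)
  qed
qed

lemma const_in_poly_space: "(\<lambda>u. c) \<in> (poly_space m :: (real ^ 'n::finite \<Rightarrow> real) set)"
proof -
  have "(\<Sum>\<alpha> | mi_deg \<alpha> \<le> m. (if \<alpha> = (\<lambda>_. 0) then c else 0) * mi_pow \<alpha> u) = c" for u :: "real ^ 'n"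
  proof -
    have "(\<Sum>\<alpha> | mi_deg \<alpha> \<le> m. (if \<alpha> = (\<lambda>_. 0) then c else 0) * mi_pow \<alpha> u)
        = (\<Sum>\<alpha> :: 'n \<Rightarrow> nat | mi_deg \<alpha> \<le> m. if \<alpha> = (\<lambda>_. 0) then c else 0)"
      by (intro sum.cong) auto
    also have "\<dots> = c" by (subst sum.delta[OF finite_mi_deg]) (simp add: mi_deg_def)
    finally show ?thesis .
  qed
  then show ?thesis
    unfolding poly_space_def by (auto intro!: exI[of _ "\<lambda>\<alpha>. if \<alpha> = (\<lambda>_. 0) then c else 0"])
qed

text \<open>
  The two hypotheses: the uniform density on the neighbourhood \<open>V\<close> of \<open>t\<close>, and the function that
  results from it by subtracting the bump \<open>L (b\<^sup>s - \<parallel>x - t\<parallel>\<^sup>s)\<^sub>+\<close> on \<open>V\<close> and adding the constant that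
  restores the mass. The second one differs from a constant by \<open>L min(b\<^sup>s, \<parallel>x - t\<parallel>\<^sup>s)\<close> on \<open>V\<close>, hence belongs to the class for every \<open>s\<close>; no smoothness
  of the bump away from \<open>t\<close> is needed. With \<open>v\<close> the volume of \<open>V\<close>, the second moment of the likelihood
  ratio of one observation is at most \<open>1 + v L\<^sup>2 b\<^sup>2\<^sup>s (2b)\<^sup>d\<close>, so it stays bounded for \<open>n\<close> observations as
  long as \<open>n b\<^sup>2\<^sup>s\<^sup>+\<^sup>d \<le> 1\<close>.
\<close>

lemma minimax_risk_lower_bound:
  fixes D :: "(real ^ 'n::finite) set"
  defines "d \<equiv> CARD('n)"
  assumes D: "closed D" and t: "t \<in> D" and \<rho>: "0 < \<rho>" and s: "0 < s" and L: "0 < L"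
    and b: "0 < b" and n: "n \<ge> 1"
    and v_def: "v = measure lborel (nbhd D t \<rho>)" and v: "0 < v"
    and small: "L * b powr s \<le> 1 / v" "(2 * b) ^ d \<le> v / 2"
    and rate: "real n * (b powr s)\<^sup>2 * b ^ d \<le> 1"
  shows "ennreal (L * b powr s / 2 / sqrt (2 * (1 + exp (v * L\<^sup>2 * 2 ^ d)))) \<le> minimax_risk D t \<rho> s L n"
proof -
  define V where "V = (\<lambda>x. x - t) -` nbhd D t \<rho>"
  have Vmeas [measurable]: "V \<in> sets borel"
  proof -
    have "(\<lambda>x. x - t) -` nbhd D t \<rho> \<inter> space borel \<in> sets borel"
      by (rule measurable_sets[OF _ nbhd_borel[OF D]]) measurable
    then show ?thesis by (simp only: V_def space_borel Int_UNIV_right)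
  qed
  have VD: "x \<in> D" if "x \<in> V" for x using that by (simp add: V_def nbhd_def)
  have tV: "t \<in> V" using t \<rho> by (simp add: V_def nbhd_def infnorm_0)
  have Vimg: "V = (+) t ` nbhd D t \<rho>"
    by (auto simp: V_def image_iff intro!: bexI[of _ "_ - t"])
  have fin: "emeasure lborel (nbhd D t \<rho>) < \<infinity>"
    using emeasure_nbhd_le[of \<rho> D t] \<rho> by (auto intro: order_le_less_trans)
  have emV: "emeasure lborel V = ennreal v"
  proof -
    have "emeasure lborel V = emeasure (distr lborel borel ((+) t)) V" by (simp add: lborel_distr_plus)
    also have "\<dots> = emeasure lborel (nbhd D t \<rho>)"
    proof -
      have "(+) t -` V = nbhd D t \<rho>" by (auto simp: V_def)
      then show ?thesis by (subst emeasure_distr) simp_all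
    qed
    also have "\<dots> = ennreal v"
      unfolding v_def using fin by (intro emeasure_eq_ennreal_measure) auto
    finally show ?thesis .
  qed
  have [simp]: "measure lborel V = v" using emV v by (simp add: measure_def)
  have Vint [simp]: "integrable lborel (indicator V :: _ \<Rightarrow> real)" "(LINT x|lborel. indicator V x) = v"
    using emV v by (auto simp: integrable_indicator_iff measure_def)
  define \<phi> where "\<phi> x = L * max 0 (b powr s - infnorm (x - t) powr s)" for x
  have [measurable]: "\<phi> \<in> borel_measurable borel"
  proof -
    have "(\<lambda>x. infnorm (x - t)) \<in> borel_measurable borel"
      by (rule measurable_compose[OF _ borel_measurable_infnorm]) measurable
    then show ?thesis unfolding \<phi>_def[abs_def] by measurable
  qed
  have \<phi>0: "0 \<le> \<phi> x" and \<phi>1: "\<phi> x \<le> L * b powr s" for x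
    using L by (auto simp: \<phi>_def)
  define W where "W = (\<lambda>x. x - t) -` {u. infnorm u \<le> b}"
  have [measurable]: "W \<in> sets borel"
  proof -
    have "(\<lambda>x. x - t) -` {u. infnorm u \<le> b} \<inter> space borel \<in> sets borel"
      by (rule measurable_sets) measurable
    then show ?thesis by (simp only: W_def space_borel Int_UNIV_right)
  qed
  have \<phi>W: "\<phi> x = 0" if "x \<notin> W" for x
  proof -
    have "b powr s \<le> infnorm (x - t) powr s" using that b s by (intro powr_mono2) (auto simp: W_def)
    then show ?thesis by (simp add: \<phi>_def)
  qed
  have emW: "emeasure lborel W = ennreal ((2 * b) ^ d)"
  proof -
    have "emeasure lborel W = emeasure (distr lborel borel ((+) t)) W" by (simp add: lborel_distr_plus)
    also have "\<dots> = emeasure lborel {u :: real ^ 'n. infnorm u \<le> b}"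
    proof -
      have "(+) t -` W = {u. infnorm u \<le> b}" by (auto simp: W_def)
      then show ?thesis by (subst emeasure_distr) simp_all
    qed
    finally show ?thesis using emeasure_infnorm_ball[of b, where 'n='n] b by (simp add: d_def)
  qed
  have Wint: "integrable lborel (indicator W :: _ \<Rightarrow> real)" "(LINT x|lborel. indicator W x) = (2 * b) ^ d"
    using emW b by (auto simp: integrable_indicator_iff measure_def)
  have bump: "integrable lborel (\<lambda>x. (\<phi> x) ^ j * indicator V x)"
    "(LINT x|lborel. (\<phi> x) ^ j * indicator V x) \<le> (L * b powr s) ^ j * (2 * b) ^ d" if "0 < j" for j
  proof -
    have le: "(\<phi> x) ^ j * indicator V x \<le> (L * b powr s) ^ j * indicator W x" for x
      using power_mono[OF \<phi>1 \<phi>0, of x j] \<phi>W[of x] \<phi>0[of x] that L by (auto simp: indicator_def zero_power)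
    have nn: "0 \<le> (\<phi> x) ^ j * indicator V x" for x using \<phi>0[of x] by simp
    have i: "integrable lborel (\<lambda>x. (L * b powr s) ^ j * indicator W x)" using Wint by simp
    show "integrable lborel (\<lambda>x. (\<phi> x) ^ j * indicator V x)"
      by (rule Bochner_Integration.integrable_bound[OF i])
        (use le nn L in \<open>auto simp: abs_of_nonneg[OF nn] simp del: abs_mult\<close>)
    then have "(LINT x|lborel. (\<phi> x) ^ j * indicator V x) \<le> (LINT x|lborel. (L * b powr s) ^ j * indicator W x)"
      using i le by (intro integral_mono) auto
    then show "(LINT x|lborel. (\<phi> x) ^ j * indicator V x) \<le> (L * b powr s) ^ j * (2 * b) ^ d"
      using Wint by simp
  qed
  define I where "I = (LINT x|lborel. \<phi> x * indicator V x)"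
  define J where "J = (LINT x|lborel. (\<phi> x)\<^sup>2 * indicator V x)"
  have Iint: "integrable lborel (\<lambda>x. \<phi> x * indicator V x)" and I1: "I \<le> L * b powr s * (2 * b) ^ d"
    using bump[of 1] by (simp_all add: I_def)
  have I0: "0 \<le> I" unfolding I_def using \<phi>0 by simp
  have Jint: "integrable lborel (\<lambda>x. (\<phi> x)\<^sup>2 * indicator V x)" and J1: "J \<le> (L * b powr s)\<^sup>2 * (2 * b) ^ d"
    using bump[of 2] by (simp_all add: J_def)
  define c where "c = (1 + I) / v"
  define r where "r x = v * (c - \<phi> x)" for x
  have [measurable]: "r \<in> borel_measurable borel" unfolding r_def[abs_def] by measurable
  have c\<phi>: "0 \<le> c - \<phi> x" for x
  proof -
    have "\<phi> x \<le> 1 / v" using \<phi>1[of x] small(1) by simp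
    also have "\<dots> \<le> c" using I0 v by (simp add: c_def divide_right_mono)
    finally show ?thesis by simp
  qed
  have r0: "0 \<le> r x" for x using c\<phi>[of x] v by (simp add: r_def)
  define f0 where "f0 x = 1 / v * indicator V x" for x
  define f1 where "f1 x = (c - \<phi> x) * indicator V x" for x
  have meas_restrict: "g \<in> borel_measurable (restrict_space borel D)" if "g \<in> borel_measurable borel"
    for g :: "real ^ 'n \<Rightarrow> real" using that by (rule measurable_restrict_space1)
  have dens: "is_density_on D g" if [measurable]: "g \<in> borel_measurable borel" and "\<And>x. 0 \<le> g x"
    and "\<And>x. x \<notin> V \<Longrightarrow> g x = 0" and "integrable lborel g" "(LINT x|lborel. g x) = 1" for g
  proof -
    have "(\<integral>\<^sup>+x\<in>D. ennreal (g x) \<partial>lborel) = (\<integral>\<^sup>+x. ennreal (g x) \<partial>lborel)"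
    proof (intro nn_integral_cong)
      fix x
      have "g x = 0" if "x \<notin> D" using VD[of x] \<open>\<And>x. x \<notin> V \<Longrightarrow> g x = 0\<close> that by blast
      then show "ennreal (g x) * indicator D x = ennreal (g x)" by (cases "x \<in> D") auto
    qed
    also have "\<dots> = 1" using that by (subst nn_integral_eq_integral) auto
    finally show ?thesis using that(2) meas_restrict[OF that(1)] by (simp add: is_density_on_def)
  qed
  have d0: "is_density_on D f0"
    by (rule dens) (use v in \<open>auto simp: f0_def[abs_def] Vint\<close>)
  have f1_int: "integrable lborel f1" "(LINT x|lborel. f1 x) = 1"
  proof -
    have e: "f1 x = c * indicator V x - \<phi> x * indicator V x" for x by (simp add: f1_def algebra_simps)
    show "integrable lborel f1" unfolding e[abs_def] using Iint by auto
    have "(LINT x|lborel. f1 x) = c * v - I" unfolding e using Iint by (simp add: I_def)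
    then show "(LINT x|lborel. f1 x) = 1" using v by (simp add: c_def)
  qed
  have d1: "is_density_on D f1"
    by (rule dens) (use c\<phi> f1_int in \<open>auto simp: f1_def[abs_def]\<close>)
  have tu: "t + u \<in> V \<longleftrightarrow> u \<in> nbhd D t \<rho>" for u by (simp add: V_def)
  have h0: "f0 \<in> holder_class D t \<rho> s L"
    unfolding holder_class_def using d0 const_in_poly_space[of "1 / v" "nat (\<lceil>s\<rceil> - 1)", where 'n='n] L
    by (auto simp: f0_def tu intro!: bexI[of _ "\<lambda>u. 1 / v"])
  have "\<bar>f1 (t + u) - (c - L * b powr s)\<bar> \<le> L * infnorm u powr s" if "u \<in> nbhd D t \<rho>" for u
  proof -
    have "f1 (t + u) - (c - L * b powr s) = L * (b powr s - max 0 (b powr s - infnorm u powr s))"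
      using that by (simp add: f1_def tu \<phi>_def algebra_simps)
    moreover have "0 \<le> b powr s - max 0 (b powr s - infnorm u powr s)"
      "b powr s - max 0 (b powr s - infnorm u powr s) \<le> infnorm u powr s" by auto
    ultimately show ?thesis using L by (simp add: abs_mult)
  qed
  then have h1: "f1 \<in> holder_class D t \<rho> s L"
    unfolding holder_class_def mem_Collect_eq
    by (intro conjI d1 bexI[of _ "\<lambda>u. c - L * b powr s"] ballI const_in_poly_space)
  define \<delta> where "\<delta> = L * b powr s / 2"
  have \<delta>: "0 < \<delta>" using L b by (simp add: \<delta>_def)
  have sep: "\<delta> \<le> \<bar>f1 t - f0 t\<bar>"
  proof -
    have "I \<le> L * b powr s * (v / 2)"
      using I1 small(2) L by (meson mult_left_mono mult_nonneg_nonneg less_imp_le order_trans powr_ge_zero)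
    then have "I / v \<le> \<delta>" using v by (simp add: \<delta>_def field_simps)
    moreover have "f1 t - f0 t = I / v - 2 * \<delta>"
      using tV s by (simp add: f1_def f0_def c_def \<phi>_def \<delta>_def infnorm_0 add_divide_distrib)
    ultimately show ?thesis by linarith
  qed
  interpret M0: prob_space "law D f0" by (rule prob_space_law[OF D d0])
  interpret PS: product_sigma_finite "\<lambda>_ :: nat. law D f0" by unfold_locales
  have law1: "law D f1 = density (law D f0) (\<lambda>x. ennreal (r x))"
  proof -
    have "density (law D f0) (\<lambda>x. ennreal (r x)) = density lborel (\<lambda>x. ennreal (f0 x) * indicator D x * ennreal (r x))"
      unfolding law_def by (rule density_density_eq) (use borel_measurable_density[OF D d0] in auto)
    also have "(\<lambda>x. ennreal (f0 x) * indicator D x * ennreal (r x)) = (\<lambda>x. ennreal (f1 x) * indicator D x)"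
    proof
      fix x
      show "ennreal (f0 x) * indicator D x * ennreal (r x) = ennreal (f1 x) * indicator D x"
        using v c\<phi>[of x] VD[of x]
        by (cases "x \<in> V") (auto simp: f0_def f1_def r_def ennreal_mult[symmetric] simp del: ennreal_mult)
    qed
    finally show ?thesis by (simp add: law_def)
  qed
  have chi: "(\<integral>\<^sup>+x. ennreal ((r x)\<^sup>2) \<partial>law D f0) \<le> ennreal (1 + v * J)"
  proof -
    have e: "v * (c - \<phi> x)\<^sup>2 * indicator V x
      = v * c\<^sup>2 * indicator V x - 2 * v * c * (\<phi> x * indicator V x) + v * ((\<phi> x)\<^sup>2 * indicator V x)" for x
      by (simp add: power2_eq_square algebra_simps)
    have "(\<integral>\<^sup>+x. ennreal ((r x)\<^sup>2) \<partial>law D f0)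
      = (\<integral>\<^sup>+x. ennreal (f0 x) * indicator D x * ennreal ((r x)\<^sup>2) \<partial>lborel)"
      by (rule nn_integral_law[OF D d0]) measurable
    also have "\<dots> = (\<integral>\<^sup>+x. ennreal (v * (c - \<phi> x)\<^sup>2 * indicator V x) \<partial>lborel)"
    proof (intro nn_integral_cong)
      fix x
      have "1 / v * (r x)\<^sup>2 = v * (c - \<phi> x)\<^sup>2" using v by (simp add: r_def power2_eq_square)
      then show "ennreal (f0 x) * indicator D x * ennreal ((r x)\<^sup>2) = ennreal (v * (c - \<phi> x)\<^sup>2 * indicator V x)"
        using v VD[of x] by (cases "x \<in> V") (auto simp: f0_def ennreal_mult[symmetric] simp del: ennreal_mult)
    qed
    also have "\<dots> = ennreal (LINT x|lborel. v * (c - \<phi> x)\<^sup>2 * indicator V x)"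
    proof (rule nn_integral_eq_integral)
      show "integrable lborel (\<lambda>x. v * (c - \<phi> x)\<^sup>2 * indicator V x)"
        unfolding e using Iint Jint by auto
      show "AE x in lborel. 0 \<le> v * (c - \<phi> x)\<^sup>2 * indicator V x"
        using v by (intro AE_I2) simp
    qed
    also have "(LINT x|lborel. v * (c - \<phi> x)\<^sup>2 * indicator V x) = v * c\<^sup>2 * v - 2 * v * c * I + v * J"
      unfolding e using Iint Jint by (simp add: I_def J_def)
    also have "\<dots> = 1 - I\<^sup>2 + v * J"
    proof -
      have "v * c = 1 + I" using v by (simp add: c_def)
      have "v * c\<^sup>2 * v - 2 * v * c * I = (v * c)\<^sup>2 - 2 * (v * c) * I"
        by (simp add: power2_eq_square)
      also have "\<dots> = 1 - I\<^sup>2"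
        unfolding \<open>v * c = 1 + I\<close> by (simp add: power2_eq_square algebra_simps)
      finally show ?thesis by simp
    qed
    finally show ?thesis by (auto intro!: ennreal_leI)
  qed
  define K where "K = v * L\<^sup>2 * 2 ^ d"
  have K: "1 + v * J \<le> 1 + K / real n"
  proof -
    have "v * J \<le> v * ((L * b powr s)\<^sup>2 * (2 * b) ^ d)" using J1 v by simp
    also have "\<dots> = K / real n * (real n * (b powr s)\<^sup>2 * b ^ d)"
      using n by (simp add: K_def power_mult_distrib)
    also have "\<dots> \<le> K / real n * 1"
      using rate v by (intro mult_left_mono) (auto simp: K_def)
    finally show ?thesis by simp
  qed
  have K0: "0 \<le> K" using v by (simp add: K_def)
  define P where "P = sample_law D n f0"
  define p where "p X = (\<Prod>i\<in>{1..n}. r (X i))" for X :: "nat \<Rightarrow> real ^ 'n"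
  have P1: "sample_law D n f1 = density P (\<lambda>X. ennreal (p X))"
  proof -
    have "PiM {1..n} (\<lambda>_. density (law D f0) (\<lambda>x. ennreal (r x)))
      = density (PiM {1..n} (\<lambda>_. law D f0)) (\<lambda>X. \<Prod>i\<in>{1..n}. ennreal (r (X i)))"
      by (rule PiM_density) (use M0.prob_space_axioms prob_space_law[OF D d1] law1 in auto)
    then show ?thesis
      using r0 by (simp add: sample_law_def law1 P_def p_def prod_ennreal)
  qed
  have p2: "(\<integral>\<^sup>+X. ennreal ((p X)\<^sup>2) \<partial>P) \<le> ennreal (exp K)"
  proof -
    have "(\<integral>\<^sup>+X. ennreal ((p X)\<^sup>2) \<partial>P) = (\<integral>\<^sup>+X. (\<Prod>i\<in>{1..n}. ennreal ((r (X i))\<^sup>2)) \<partial>PiM {1..n} (\<lambda>_. law D f0))"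
      by (simp add: P_def sample_law_def p_def prod_ennreal prod_power_distrib)
    also have "\<dots> = (\<Prod>i\<in>{1..n}. \<integral>\<^sup>+x. ennreal ((r x)\<^sup>2) \<partial>law D f0)"
      by (rule PS.product_nn_integral_prod) auto
    also have "\<dots> = (\<integral>\<^sup>+x. ennreal ((r x)\<^sup>2) \<partial>law D f0) ^ n" by simp
    also have "\<dots> \<le> ennreal (1 + K / real n) ^ n"
      using chi ennreal_leI[OF K] by (intro power_mono) auto
    also have "\<dots> = ennreal ((1 + K / real n) ^ n)" using K0 by (intro ennreal_power) auto
    also have "\<dots> \<le> ennreal (exp K)"
      using exp_ge_one_plus_x_over_n_power_n[of n K] n K0 by (intro ennreal_leI) auto
    finally show ?thesis .
  qed
  have setsP: "sets P = sets (PiM {1..n} (\<lambda>_. borel))"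
    unfolding P_def sample_law_def by (intro sets_PiM_cong) auto
  have pmeas: "p \<in> borel_measurable P"
    unfolding p_def[abs_def] measurable_cong_sets[OF setsP refl] by measurable
  have p1: "(\<integral>\<^sup>+X. ennreal (p X) \<partial>P) = 1"
  proof -
    interpret Q: prob_space "sample_law D n f1"
      unfolding sample_law_def by (rule prob_space_PiM) (rule prob_space_law[OF D d1])
    have "(\<integral>\<^sup>+X. ennreal (p X) \<partial>P) = emeasure (sample_law D n f1) (space (sample_law D n f1))"
      unfolding P1 using pmeas by (subst emeasure_density) (auto intro!: nn_integral_cong)
    then show ?thesis using Q.emeasure_space_1 by simp
  qed
  have p0: "0 \<le> p X" for X using r0 by (simp add: p_def prod_nonneg)
  have "ennreal (\<delta> / sqrt (2 * (1 + exp K))) \<le> max_risk D t \<rho> s L n g" if g: "g \<in> estimators n" for g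
  proof -
    define R where "R = max_risk D t \<rho> s L n g"
    have mse: "(\<integral>\<^sup>+X. ennreal ((g X - f t)\<^sup>2) \<partial>sample_law D n f) \<le> R\<^sup>2" if "f \<in> holder_class D t \<rho> s L" for f
    proof (rule ennreal_sqrt_le_imp_le_square)
      show "ennreal_sqrt (\<integral>\<^sup>+X. ennreal ((g X - f t)\<^sup>2) \<partial>sample_law D n f) \<le> R"
        unfolding R_def max_risk_def risk_def[symmetric] by (rule SUP_upper[OF that])
    qed
    have gmeas: "g \<in> borel_measurable P"
      using g unfolding estimators_def measurable_cong_sets[OF setsP refl] .
    have "ennreal (\<delta>\<^sup>2 / 2) \<le> ennreal (1 + exp K) * R\<^sup>2"
      by (rule two_point_risk_lower_bound[OF pmeas gmeas p0 p1 _ p2 \<delta> sep])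
        (use mse[OF h0] mse[OF h1] in \<open>simp_all add: P1 P_def[symmetric]\<close>)
    then show ?thesis
    proof (cases R)
      case (real a)
      assume "ennreal (\<delta>\<^sup>2 / 2) \<le> ennreal (1 + exp K) * R\<^sup>2"
      then have "ennreal (\<delta>\<^sup>2 / 2) \<le> ennreal ((1 + exp K) * a\<^sup>2)"
        using real by (simp add: ennreal_power ennreal_mult add_pos_pos less_imp_le)
      then have "\<delta>\<^sup>2 / 2 \<le> (1 + exp K) * a\<^sup>2"
        by (subst (asm) ennreal_le_iff) (auto simp: add_nonneg_nonneg)
      moreover have pos: "0 < 1 + exp K" by (simp add: add_pos_pos)
      ultimately have "(\<delta> / sqrt (2 * (1 + exp K)))\<^sup>2 \<le> a\<^sup>2"
        by (simp add: power_divide field_simps)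
      then have "\<delta> / sqrt (2 * (1 + exp K)) \<le> a" using real(1) by (rule power2_le_imp_le)
      then show ?thesis using real by (simp add: R_def[symmetric] ennreal_leI)
    qed (simp add: R_def[symmetric])
  qed
  then show ?thesis
    unfolding minimax_risk_def K_def \<delta>_def by (intro INF_greatest) auto
qed

section \<open>Rate of convergence\<close>

lemma lesssimI:
  fixes u v :: "nat \<Rightarrow> ennreal"
  assumes "c < \<infinity>" "\<forall>\<^sub>F n in sequentially. u n \<le> c * v n"
  shows "u \<lesssim> v"
proof -
  have le: "u n / v n \<le> c" if "u n \<le> c * v n" for n
  proof -
    have "u n / v n \<le> c * v n / v n" using that by (rule divide_right_mono_ennreal)
    also have "\<dots> \<le> c"
      by (cases "v n = 0 \<or> v n = \<infinity>") (auto simp: mult_divide_eq_ennreal)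
    finally show ?thesis .
  qed
  have "limsup (\<lambda>n. u n / v n) \<le> c"
    by (rule Limsup_bounded) (use assms(2) le in \<open>auto elim: eventually_mono\<close>)
  then show ?thesis using assms(1) unfolding lesssim_def by (rule order_le_less_trans)
qed

text \<open>
  The two sides of the bias-variance trade-off at the bandwidth \<open>h\<close>, which minimizes
  \<open>c\<^sup>2h\<^sup>2\<^sup>s + F/(2\<^sup>dnh\<^sup>d)\<close> over \<open>h > 0\<close>.
\<close>

lemma optimal_bandwidth:
  fixes s d c F n :: real
  assumes pos: "0 < s" "0 < d" "0 < c" "0 < F" "0 < n"
  defines "h \<equiv> (1 / (2 * s * c\<^sup>2) * (d * F / (2 powr d * n))) powr (1 / (2 * s + d))"
  defines "E \<equiv> F / (2 powr d * n * h powr d)"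
  shows "0 < h" "c\<^sup>2 * (h powr s)\<^sup>2 = d / (2 * s) * E"
    and "E = (2 * s / (4 powr s * d)) powr (d / (2 * s + d)) * (F powr (s / (2 * s + d)))\<^sup>2
      * (c powr (d / (2 * s + d)))\<^sup>2 * (n powr (- s / (2 * s + d)))\<^sup>2" (is "_ = ?R")
proof -
  define X where "X = 1 / (2 * s * c\<^sup>2) * (d * F / (2 powr d * n))"
  have X: "0 < X" using pos by (simp add: X_def)
  show h: "0 < h" unfolding h_def X_def[symmetric] using X by simp
  have sd: "2 * s + d > 0" using pos by simp
  have "h powr (2 * s + d) = X" unfolding h_def X_def[symmetric] using X sd by (simp add: powr_powr)
  then have hX: "(h powr s)\<^sup>2 * h powr d = X"
    by (simp add: power2_eq_square powr_add[symmetric])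
  have "c\<^sup>2 * (h powr s)\<^sup>2 = c\<^sup>2 * X / h powr d" using h by (simp add: hX[symmetric])
  also have "\<dots> = d / (2 * s) * E" using pos h by (simp add: X_def E_def field_simps)
  finally show "c\<^sup>2 * (h powr s)\<^sup>2 = d / (2 * s) * E" .
  have E: "0 < E" using pos h by (simp add: E_def)
  have R: "0 < ?R" using pos by simp
  define q where "q = d / (2 * s + d)"
  define p where "p = s / (2 * s + d)"
  have p: "2 * p = 1 - q" using sd by (simp add: p_def q_def field_simps)
  have q: "2 * s * q = d - q * d" using sd by (simp add: q_def field_simps)
  have lnX: "ln X = ln d + ln F - ln 2 - ln s - 2 * ln c - d * ln 2 - ln n"
    using pos by (simp add: X_def ln_mult ln_div ln_powr ln_realpow)
  have ln4: "ln (4::real) = 2 * ln 2"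
    using ln_realpow[of "2::real" 2] by simp
  have "ln (h powr d) = q * ln X"
  proof -
    have "h = X powr (1 / (2 * s + d))" by (simp only: h_def X_def)
    then show ?thesis using X by (simp add: q_def ln_powr)
  qed
  then have "ln E = ln F - d * ln 2 - ln n - q * ln X"
    using pos h by (simp add: E_def ln_mult ln_div ln_powr)
  also have "\<dots> = q * (ln 2 + ln s - s * (2 * ln 2) - ln d) + 2 * (p * ln F) + 2 * (q * ln c) + 2 * (- p * ln n)"
  proof -
    have "2 * (p * ln F) = (1 - q) * ln F" "2 * (- p * ln n) = - (1 - q) * ln n"
      using p by (metis mult.assoc) (metis mult.assoc mult_minus_left mult_minus_right p)
    moreover have "q * (s * (2 * ln 2)) = (d - q * d) * ln 2"
      using q by (metis mult.assoc mult.commute)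
    ultimately show ?thesis unfolding lnX by (simp add: algebra_simps)
  qed
  also have "\<dots> = ln ?R"
    using pos unfolding q_def[symmetric] p_def[symmetric] minus_divide_left[symmetric]
    by (simp add: ln_mult ln_div ln_powr ln_realpow ln4)
  finally show "E = ?R" using E R by simp
qed

text \<open>
  With \<open>E\<close> as in the preceding lemma and \<open>K = 4\<^sup>d D\<^sub>m / lam\<^sup>2\<close>, the squared bias is at most \<open>K (d/2s) E\<close>.
  The bound \<open>2\<^sup>d E / lam\<close> on the variance is at most \<open>K E\<close>, because \<open>lam \<le> 2\<^sup>d \<le> 2\<^sup>d D\<^sub>m\<close>. The sum of the two bounds is the square
  of \<open>C n\<^sup>-\<^sup>s\<^sup>/\<^sup>(\<^sup>2\<^sup>s\<^sup>+\<^sup>d\<^sup>)\<close>.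
\<close>

lemma max_risk_lp_estimator_le:
  fixes D :: "(real ^ 'n::{finite,linorder}) set" and t :: "real ^ 'n::{finite,linorder}"
  defines "d \<equiv> real CARD('n)"
  assumes D: "closed D" and s: "0 < s" and m: "m = nat (\<lceil>s\<rceil> - 1)"
    and bias: "is_bias_const D t \<rho> m s L biasC"
    and sup: "is_sup_bound D t \<rho> s L supF"
    and lam: "is_eigenvalue_bound D t \<rho> m lam"
    and n: "n \<ge> 1"
    and h_def: "h = (1 / (2 * s * biasC\<^sup>2) * (d * supF / (2 powr d * real n))) powr (1 / (2 * s + d))"
    and h\<rho>: "h \<le> \<rho>"
    and C_def: "C = 2 powr d * sqrt (real (poly_dim TYPE('n) m)) / lam
             * sqrt ((d / (2 * s) + 1) * (2 * s / (4 powr s * d)) powr (d / (2 * s + d)))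
             * supF powr (s / (2 * s + d)) * biasC powr (d / (2 * s + d))"
  shows "max_risk D t \<rho> s L n (lp_estimator D t m h n) \<le> ennreal (C * real n powr (- s / (2 * s + d)))"
proof -
  have d: "0 < d" by (simp add: d_def)
  have pos: "0 < biasC" "0 < supF" "0 < lam" "0 < real n"
    using bias sup lam n by (auto simp: is_bias_const_def is_sup_bound_def is_eigenvalue_bound_def)
  note opt = optimal_bandwidth[OF s d pos(1,2,4), folded h_def]
  have h: "0 < h" by (rule opt(1))
  define E where "E = supF / (2 powr d * real n * h powr d)"
  have E: "0 \<le> E" using pos h by (simp add: E_def)
  define Dm where "Dm = real (poly_dim TYPE('n) m)"
  have "0 < (m + CARD('n)) choose CARD('n)" by (rule zero_less_binomial) simp
  then have Dm: "1 \<le> Dm" by (simp add: Dm_def poly_dim_def Suc_le_eq)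
  define G where "G = gram_mat D t m h"
  have lam_le: "lam \<le> min_eigenvalue G"
    using lam h h\<rho> by (simp add: is_eigenvalue_bound_def G_def)
  have two_d: "2 powr d = 2 ^ CARD('n)" and h_d: "h powr d = h ^ CARD('n)"
    using h by (simp_all add: d_def powr_realpow)
  have mass: "0 \<le> kernel_mass D t h" "kernel_mass D t h \<le> 2 powr d"
    using kernel_mass_le[OF D h] two_d by auto
  have lam2: "lam \<le> 2 powr d"
    using lam_le min_eigenvalue_gram_le[OF D h, of t m] mass by (simp add: G_def)
  define N where "N = real n powr (- s / (2 * s + d))"
  define K where "K = (2 powr d)\<^sup>2 * Dm / lam\<^sup>2"
  have K: "0 \<le> K" using Dm by (simp add: K_def)
  have CN: "(C * N)\<^sup>2 = K * (d / (2 * s) + 1) * E"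
  proof -
    have "(sqrt ((d / (2 * s) + 1) * (2 * s / (4 powr s * d)) powr (d / (2 * s + d))))\<^sup>2
      = (d / (2 * s) + 1) * (2 * s / (4 powr s * d)) powr (d / (2 * s + d))"
      using s d by (intro real_sqrt_pow2) auto
    moreover have "(sqrt Dm)\<^sup>2 = Dm" using Dm by simp
    ultimately show ?thesis
      unfolding C_def N_def E_def opt(3) K_def Dm_def[symmetric] power_mult_distrib power_divide
      by (simp only: mult_ac times_divide_eq_left times_divide_eq_right)
  qed
  have C0: "0 \<le> C * N" unfolding C_def N_def using s d pos by simp
  have "risk D t n (lp_estimator D t m h n) f \<le> ennreal (C * N)" if f: "f \<in> holder_class D t \<rho> s L" for f
  proof -
    have dens: "is_density_on D f" using f by (simp add: holder_class_def)
    have fle: "f (t + u) \<le> supF" if "u \<in> nbhd D t h" for u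
    proof -
      have "u \<in> nbhd D t \<rho>" using that h\<rho> by (auto simp: nbhd_def)
      then show ?thesis using sup f by (fastforce simp: is_sup_bound_def)
    qed
    define e where "e = (LINT X|sample_law D n f. lp_estimator D t m h n X) - f t"
    have "real m + 1 = real_of_int \<lceil>s\<rceil>" using m s by simp
    then have "min (real m + 1) s = s" by (metis le_of_int_ceiling min_absorb2)
    then have "\<bar>e\<bar> \<le> kernel_mass D t h * sqrt Dm / min_eigenvalue G * biasC * h powr s"
      using bias n h h\<rho> f unfolding is_bias_const_def e_def Dm_def G_def by metis
    also have "\<dots> \<le> 2 powr d * sqrt Dm / lam * biasC * h powr s"
      using mass lam_le pos Dm by (intro mult_right_mono frac_le) auto
    finally have "e\<^sup>2 \<le> (2 powr d * sqrt Dm / lam * biasC * h powr s)\<^sup>2"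
      using power_mono[OF _ abs_ge_zero, of e _ 2] by simp
    also have "\<dots> = K * (biasC\<^sup>2 * (h powr s)\<^sup>2)"
      using Dm by (simp add: K_def power_mult_distrib power_divide)
    also have "\<dots> = K * (d / (2 * s) * E)" unfolding E_def opt(2) ..
    finally have e2: "e\<^sup>2 \<le> K * (d / (2 * s)) * E" by (simp add: mult.assoc)
    have var: "supF / (real n * h ^ CARD('n) * lam) \<le> K * E"
    proof -
      have "supF / (real n * h ^ CARD('n) * lam) = 2 powr d / lam * E"
        using pos h by (simp add: E_def h_d field_simps)
      also have "2 powr d / lam \<le> K"
      proof -
        have "lam * 1 \<le> 2 powr d * Dm" using lam2 Dm pos by (intro mult_mono) auto
        then show ?thesis using pos by (simp add: K_def field_simps power2_eq_square)
      qed
      finally show ?thesis using E by (simp add: mult_right_mono)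
    qed
    have "(\<integral>\<^sup>+X. ennreal ((lp_estimator D t m h n X - f t)\<^sup>2) \<partial>sample_law D n f)
      \<le> ennreal (e\<^sup>2 + supF / (real n * h ^ CARD('n) * lam))"
      unfolding e_def using lam_le pos fle
      by (intro lp_estimator_risk[OF D dens h n]) (auto simp: G_def)
    also have "\<dots> \<le> ennreal ((C * N)\<^sup>2)"
      unfolding CN using e2 var by (intro ennreal_leI) (simp add: algebra_simps)
    finally show ?thesis unfolding risk_def by (rule ennreal_sqrt_le[OF C0])
  qed
  then show ?thesis unfolding max_risk_def N_def[symmetric] by (rule SUP_least)
qed

theorem proposition4p4:
  fixes D :: "(real ^ 'n::{finite,linorder}) set"
    and t :: "real ^ 'n::{finite,linorder}"
    and d \<rho> s L biasC supF lam :: real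
    and \<Delta>\<^sub>0 :: "(real ^ 'n::{finite,linorder}) set"
    and m :: nat
    and h N :: "nat \<Rightarrow> real"
  assumes "d = real CARD('n)"
    and "\<exists>U. open U \<and> U \<noteq> {} \<and> D = closure U"
    and "t \<in> D"
    and "0 < \<rho>" and "\<rho> \<le> exp (-1)"
    and "\<exists>U. openin (top_of_set ((\<lambda>x. x - t) ` D)) U \<and> 0 \<in> U \<and> U \<subseteq> nbhd D t \<rho>"
    and "open \<Delta>\<^sub>0" and "\<Delta>\<^sub>0 \<noteq> {}" and "\<Delta>\<^sub>0 \<subseteq> cbox (-1) 1"
    and "\<And>b. 0 < b \<Longrightarrow> b \<le> \<rho> \<Longrightarrow> (\<lambda>u. b *\<^sub>R u) ` \<Delta>\<^sub>0 \<subseteq> nbhd D t b"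
    and "0 < s" and "0 < L"
    and "m = nat (\<lceil>s\<rceil> - 1)"
    and "is_bias_const D t \<rho> m s L biasC"
    and "is_sup_bound D t \<rho> s L supF"
    and "is_eigenvalue_bound D t \<rho> m lam"
    and "\<And>n. n \<ge> 1 \<Longrightarrow>
      h n = (1 / (2 * s * biasC\<^sup>2) * (d * supF / (2 powr d * real n))) powr (1 / (2 * s + d))"
    and "\<And>n. n \<ge> 1 \<Longrightarrow> N n = real n powr (- s / (2 * s + d))"
  shows "is_minimax_rate D t \<rho> s L N \<and>
    (\<lambda>n. max_risk D t \<rho> s L n (lp_estimator D t m (h n) n)) \<lesssim> (\<lambda>n. ennreal (N n)) \<and>
    (\<forall>\<^sub>F n in sequentially. h n \<in> {0<..\<rho>} \<and>
      ennreal (1 / N n) * max_risk D t \<rho> s L n (lp_estimator D t m (h n) n)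
        \<le> ennreal (2 powr d * sqrt (real (poly_dim TYPE('n) m)) / lam
             * sqrt ((d / (2 * s) + 1) * (2 * s / (4 powr s * d)) powr (d / (2 * s + d)))
             * supF powr (s / (2 * s + d)) * biasC powr (d / (2 * s + d))))"
proof -
  have D: "closed D" using assms(2) by auto
  note d_def = assms(1) and s = \<open>0 < s\<close> and L = \<open>0 < L\<close>
  have d: "0 < d" by (simp add: d_def)
  have pos: "0 < biasC" "0 < supF" "0 < lam"
    using assms(14-16) by (auto simp: is_bias_const_def is_sup_bound_def is_eigenvalue_bound_def)
  define C where "C = 2 powr d * sqrt (real (poly_dim TYPE('n) m)) / lam
             * sqrt ((d / (2 * s) + 1) * (2 * s / (4 powr s * d)) powr (d / (2 * s + d)))
             * supF powr (s / (2 * s + d)) * biasC powr (d / (2 * s + d))"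
  have C: "0 \<le> C" using s d pos by (simp add: C_def)
  have N: "0 < N n" if "n \<ge> 1" for n using assms(18)[OF that] that by simp
  have ge1: "\<forall>\<^sub>F n :: nat in sequentially. n \<ge> 1" by (rule eventually_ge_at_top)
  have h_pos: "0 < h n" if "n \<ge> 1" for n
    using assms(17)[OF that] optimal_bandwidth(1)[OF s d pos(1,2), of "real n"] that by simp
  have "\<forall>\<^sub>F n in sequentially. h n \<le> \<rho>"
  proof -
    let ?k = "1 / (2 * s * biasC\<^sup>2) * (d * supF / 2 powr d)"
    have "(\<lambda>n. (?k / real n) powr (1 / (2 * s + d))) \<longlonglongrightarrow> 0"
      using s d pos by (intro tendsto_zero_powrI[OF lim_const_over_n tendsto_const]) (auto intro!: always_eventually)
    then have "\<forall>\<^sub>F n in sequentially. (?k / real n) powr (1 / (2 * s + d)) < \<rho>"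
      using \<open>0 < \<rho>\<close> by (rule order_tendstoD(2))
    with ge1 show ?thesis
    proof eventually_elim
      case (elim n)
      then show ?case using assms(17)[of n] by (simp add: mult.assoc)
    qed
  qed
  with ge1 have upper: "\<forall>\<^sub>F n in sequentially. n \<ge> 1 \<and> h n \<in> {0<..\<rho>} \<and>
      max_risk D t \<rho> s L n (lp_estimator D t m (h n) n) \<le> ennreal C * ennreal (N n)"
  proof eventually_elim
    case (elim n)
    have "max_risk D t \<rho> s L n (lp_estimator D t m (h n) n) \<le> ennreal (C * real n powr (- s / (2 * s + d)))"
      using max_risk_lp_estimator_le[OF D s assms(13-16) elim(1) _ elim(2), folded d_def, OF assms(17)[OF elim(1)] C_def] .
    then show ?case using elim h_pos[of n] C N[of n] assms(18)[of n] by (simp add: ennreal_mult)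
  qed
  have minimax_upper: "minimax_risk D t \<rho> s L \<lesssim> (\<lambda>n. ennreal (N n))"
  proof (rule lesssimI[of "ennreal C"])
    show "\<forall>\<^sub>F n in sequentially. minimax_risk D t \<rho> s L n \<le> ennreal C * ennreal (N n)"
      using upper
    proof eventually_elim
      case (elim n)
      have "lp_estimator D t m (h n) n \<in> estimators n"
        using elim pos(3) assms(16) by (intro lp_estimator_measurable[OF D, of _ lam]) (auto simp: is_eigenvalue_bound_def)
      then have "minimax_risk D t \<rho> s L n \<le> max_risk D t \<rho> s L n (lp_estimator D t m (h n) n)"
        unfolding minimax_risk_def by (rule INF_lower)
      then show ?case using elim by auto
    qed
  qed simp
  have minimax_lower: "(\<lambda>n. ennreal (N n)) \<lesssim> minimax_risk D t \<rho> s L"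
  proof -
    define v where "v = measure lborel (nbhd D t \<rho>)"
    have v: "0 < v"
    proof -
      have "open ((\<lambda>u. \<rho> *\<^sub>R u) ` \<Delta>\<^sub>0)" using assms(7) \<open>0 < \<rho>\<close> by (intro open_scaling) auto
      moreover have "(\<lambda>u. \<rho> *\<^sub>R u) ` \<Delta>\<^sub>0 \<noteq> {}" using assms(8) by simp
      ultimately obtain z e where z: "0 < e" "ball z e \<subseteq> (\<lambda>u. \<rho> *\<^sub>R u) ` \<Delta>\<^sub>0"
        by (meson all_not_in_conv open_contains_ball)
      have sub: "ball z e \<subseteq> nbhd D t \<rho>" using z(2) assms(10)[of \<rho>] \<open>0 < \<rho>\<close> by auto
      have "0 < measure lborel (ball z e)" using z(1) content_ball_pos by simp
      also have "\<dots> \<le> v"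
        unfolding v_def
      proof (rule measure_mono_fmeasurable[OF sub])
        show "nbhd D t \<rho> \<in> fmeasurable lborel"
          using emeasure_nbhd_le[of \<rho> D t] \<open>0 < \<rho>\<close> nbhd_borel[OF D]
          by (intro fmeasurableI) (auto intro: order_le_less_trans)
      qed simp
      finally show ?thesis .
    qed
    define b where "b n = real n powr (- (1 / (2 * s + d)))" for n :: nat
    define k where "k = L / 2 / sqrt (2 * (1 + exp (v * L\<^sup>2 * 2 ^ CARD('n))))"
    have k: "0 < k" using L by (simp add: k_def add_pos_pos)
    have b_lim: "b \<longlonglongrightarrow> 0"
      unfolding b_def[abs_def] using s d by (intro tendsto_neg_powr filterlim_real_sequentially) auto
    have "(\<lambda>n. (2 * b n) ^ CARD('n)) \<longlonglongrightarrow> (2 * 0) ^ CARD('n)"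
      by (intro tendsto_intros b_lim)
    then have "(\<lambda>n. (2 * b n) ^ CARD('n)) \<longlonglongrightarrow> 0" by (simp add: zero_power)
    then have ev1: "\<forall>\<^sub>F n in sequentially. (2 * b n) ^ CARD('n) < v / 2"
      using v by (rule order_tendstoD(2)[OF _ half_gt_zero])
    have "(\<lambda>n. L * b n powr s) \<longlonglongrightarrow> L * 0"
      using s by (intro tendsto_mult tendsto_const tendsto_zero_powrI[OF b_lim]) (auto simp: b_def)
    then have ev2: "\<forall>\<^sub>F n in sequentially. L * b n powr s < 1 / v"
      using v by (intro order_tendstoD(2)[of _ "0 :: real"]) auto
    show ?thesis
    proof (rule lesssimI[of "ennreal (1 / k)"])
      show "\<forall>\<^sub>F n in sequentially. ennreal (N n) \<le> ennreal (1 / k) * minimax_risk D t \<rho> s L n"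
        using ge1 ev1 ev2
      proof eventually_elim
        case (elim n)
        have b: "0 < b n" using elim(1) by (simp add: b_def)
        have bN: "b n powr s = N n" using assms(18)[OF elim(1)] by (simp add: b_def powr_powr)
        have "(b n powr s)\<^sup>2 * b n ^ CARD('n) = b n powr (2 * s + d)"
          using b by (simp add: d_def power2_eq_square powr_add[symmetric] powr_realpow[symmetric])
        also have "\<dots> = real n powr (- 1)"
          using s d by (simp add: b_def powr_powr)
        finally have rate: "real n * (b n powr s)\<^sup>2 * b n ^ CARD('n) \<le> 1"
          using elim(1) by (simp add: powr_minus mult.assoc)
        have "ennreal (L * b n powr s / 2 / sqrt (2 * (1 + exp (v * L\<^sup>2 * 2 ^ CARD('n))))) \<le> minimax_risk D t \<rho> s L n"
          using minimax_risk_lower_bound[OF D \<open>t \<in> D\<close> \<open>0 < \<rho>\<close> s L b elim(1) v_def v _ _ rate] elim(2,3)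
          by simp
        then have low: "ennreal (k * N n) \<le> minimax_risk D t \<rho> s L n"
          by (simp add: k_def bN mult_ac)
        have "ennreal (N n) = ennreal (1 / k) * ennreal (k * N n)"
          using k N[OF elim(1)] by (simp add: ennreal_mult[symmetric])
        also have "\<dots> \<le> ennreal (1 / k) * minimax_risk D t \<rho> s L n"
          using low by (intro mult_left_mono) auto
        finally show ?case .
      qed
    qed simp
  qed
  have "(\<lambda>n. max_risk D t \<rho> s L n (lp_estimator D t m (h n) n)) \<lesssim> (\<lambda>n. ennreal (N n))"
    using upper by (intro lesssimI[of "ennreal C"]) (auto elim: eventually_mono)
  moreover have "\<forall>\<^sub>F n in sequentially. h n \<in> {0<..\<rho>} \<and>
      ennreal (1 / N n) * max_risk D t \<rho> s L n (lp_estimator D t m (h n) n) \<le> ennreal C"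
    using upper
  proof eventually_elim
    case (elim n)
    then have "ennreal (1 / N n) * max_risk D t \<rho> s L n (lp_estimator D t m (h n) n)
      \<le> ennreal (1 / N n) * (ennreal C * ennreal (N n))"
      by (intro mult_left_mono) auto
    also have "\<dots> = ennreal C"
      using N[of n] C elim by (simp add: ennreal_mult[symmetric])
    finally show ?case using elim by blast
  qed
  ultimately show ?thesis
    using minimax_upper minimax_lower unfolding is_minimax_rate_def C_def by blast
qed

end
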